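(* Let $(M,g)$ be a compact Riemannian manifold of dimension $n\ge 3$ with smooth boundary, $\bar M=M\cup\partial M$. Let $\Gamma\subset\mathbb{R}^n$ be an open symmetric convex cone with vertex at the origin, $\partial\Gamma\ne\emptyset$, $\Gamma_n\subseteq\Gamma\subseteq\Gamma_1$, and let $f:\Gamma\to\mathbb{R}$ be a smooth symmetric concave function such that for each $\sigma<\sup_\Gamma f$ and each $\lambda\in\Gamma$, $\lim_{t\to+\infty}f(t\lambda)>\sigma$. Let $\psi$ be a smooth positive function on $\bar M$ and consider the equation $$f\Big(\lambda\big(\Delta u\, g-\nabla^2u+\tfrac1{n-2}G_g+\tfrac{n-3}{2}|\nabla u|^2g+du\otimes du\big)\Big)=\frac{\psi e^{2u}}{n-2}.$$ If $\Gamma\ne\Gamma_n$, then this equation is of fully uniform ellipticity for the solutions $u$ with $\lambda(G_{\tilde g})\in\Gamma$ in $\bar M$, where $\tilde g=e^{2u}g$; if $\Gamma=\Gamma_n$, then it is of $(n-1)$-uniform ellipticity for such solutions.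
   Context: $\nabla u$, $\nabla^2u$, $\Delta u=\mathrm{tr}_g\nabla^2u$ are gradient, Hessian and Laplacian with respect to $g$; $\lambda(B)$ denotes the eigenvalues of a symmetric $(0,2)$-tensor $B$ with respect to $g$. $G_g=\mathrm{Ric}_g-\frac12\mathrm{R}_g\,g$ is the Einstein tensor; under $\tilde g=e^{2u}g$, $\frac1{n-2}G_{\tilde g}=\frac1{n-2}G_g+\Delta u\,g-\nabla^2u+\frac{n-3}2|\nabla u|^2g+du\otimes du$. $\Gamma_n=\{\lambda\in\mathbb{R}^n:\lambda_i>0\ \forall i\}$, $\Gamma_1=\{\lambda\in\mathbb{R}^n:\sum_i\lambda_i>0\}$. A second order equation $\Phi(x,u,\nabla u,\nabla^2u)=0$ is of $k$-uniform ellipticity for a class of solutions if there is a constant $\theta>0$ (uniform over the class and over $x\in \bar M$) such that the coefficient matrix $a^{ij}=\partial \Phi/\partial(\nabla_{ij}u)$ of the second order part of the linearized operator at any such solution has eigenvalues (with respect to $g$) $a_1\ge\cdots\ge a_n\ge0$ with $\sum_j a_j>0$ and $a_i\ge\theta\sum_{j=1}^na_j$ for all $1\le i\le k$. Fully uniform ellipticity means $n$-uniform ellipticity. Here $\Phi$ is the left side minus the right side of the equation.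
   Formalization: Only solutions with ψe^{2u}/(n−2) < sup_Γ f on M̄ are considered; this is automatic unless f attains its supremum, and where equality holds all a^{ij} vanish (e.g. f ≡ 1, ψ = n−2, u = 0 on a hyperbolic ball), so the claim fails there. *)

theory Defs
  imports "HOL-Analysis.Analysis"
begin

section \<open>Calculus on relatively open subsets of a half-space\<close>

text \<open>
  All derivatives are taken within the coordinate domain \<open>S\<close>. For \<open>S\<close> relatively open in a
  half-space they are uniquely determined, and at boundary points they are the derivatives of
  functions that are differentiable up to the boundary.
\<close>

definition pd :: "(real^'n) set \<Rightarrow> 'n \<Rightarrow> (real^'n \<Rightarrow> real) \<Rightarrow> real^'n \<Rightarrow> real" where
  "pd S i h y = frechet_derivative h (at y within S) (axis i 1)"

fun Ck_on :: "nat \<Rightarrow> (real^'n) set \<Rightarrow> (real^'n \<Rightarrow> real) \<Rightarrow> bool" where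
  "Ck_on 0 S h = continuous_on S h"
| "Ck_on (Suc k) S h = (h differentiable_on S \<and> (\<forall>i. Ck_on k S (pd S i h)))"

definition smooth_fun_on :: "(real^'n) set \<Rightarrow> (real^'n \<Rightarrow> real) \<Rightarrow> bool" where
  "smooth_fun_on S h \<longleftrightarrow> (\<forall>k. Ck_on k S h)"

definition jacobian :: "(real^'n) set \<Rightarrow> (real^'n \<Rightarrow> real^'n) \<Rightarrow> real^'n \<Rightarrow> real^'n^'n" where
  "jacobian S h y = (\<chi> i j. pd S j (\<lambda>z. h z $ i) y)"


section \<open>Compact manifolds with boundary and Riemannian metrics\<close>

text \<open>A chart is a domain together with its coordinate map.\<close>

type_synonym ('a, 'n) chart = "'a set \<times> ('a \<Rightarrow> real^'n)"

abbreviation chart_dom :: "('a, 'n::finite) chart \<Rightarrow> 'a set" where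
  "chart_dom c \<equiv> fst c"

abbreviation coord :: "('a, 'n::finite) chart \<Rightarrow> 'a \<Rightarrow> real^'n" where
  "coord c \<equiv> snd c"

definition chart_image :: "('a, 'n::finite) chart \<Rightarrow> (real^'n) set" where
  "chart_image c = coord c ` chart_dom c"

definition chart_point :: "('a, 'n::finite) chart \<Rightarrow> real^'n \<Rightarrow> 'a" where
  "chart_point c = inv_into (chart_dom c) (coord c)"

definition chart_overlap :: "('a, 'n::finite) chart \<Rightarrow> ('a, 'n) chart \<Rightarrow> (real^'n) set" where
  "chart_overlap c d = coord c ` (chart_dom c \<inter> chart_dom d)"

definition transition :: "('a, 'n::finite) chart \<Rightarrow> ('a, 'n) chart \<Rightarrow> real^'n \<Rightarrow> real^'n" where
  "transition c d = coord d \<circ> chart_point c"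

definition is_chart :: "'a::topological_space set \<Rightarrow> ('a, 'n::finite) chart \<Rightarrow> bool" where
  "is_chart M c \<longleftrightarrow>
     openin (top_of_set M) (chart_dom c) \<and>
     (\<exists>k. openin (top_of_set {y. 0 \<le> y $ k}) (chart_image c)) \<and>
     homeomorphism (chart_dom c) (chart_image c) (coord c) (chart_point c)"

text \<open>
  The carrier \<open>M\<close> contains the boundary points. Second countability of \<open>M\<close> follows from
  compactness; the boundary may be empty.
\<close>

definition compact_smooth_manifold ::
    "'a::t2_space set \<Rightarrow> ('a, 'n::finite) chart set \<Rightarrow> bool" where
  "compact_smooth_manifold M A \<longleftrightarrow>
     compact M \<and> (\<forall>c\<in>A. is_chart M c) \<and> (\<Union>c\<in>A. chart_dom c) = M \<and>
     (\<forall>c\<in>A. \<forall>d\<in>A. \<forall>i. smooth_fun_on (chart_overlap c d) (\<lambda>y. transition c d y $ i))"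

definition Ck_fun :: "nat \<Rightarrow> ('a, 'n::finite) chart set \<Rightarrow> ('a \<Rightarrow> real) \<Rightarrow> bool" where
  "Ck_fun k A u \<longleftrightarrow> (\<forall>c\<in>A. Ck_on k (chart_image c) (u \<circ> chart_point c))"

definition smooth_fun :: "('a, 'n::finite) chart set \<Rightarrow> ('a \<Rightarrow> real) \<Rightarrow> bool" where
  "smooth_fun A u \<longleftrightarrow> (\<forall>k. Ck_fun k A u)"

text \<open>
  A metric is given by its component matrices: \<open>g c y\<close> is the matrix \<open>(g\<^sub>i\<^sub>j)\<close> in the
  chart \<open>c\<close> at the point with coordinates \<open>y\<close>.
\<close>

type_synonym ('a, 'n) metric = "('a, 'n) chart \<Rightarrow> real^'n \<Rightarrow> real^'n^'n"

definition riemannian_metric ::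
    "('a, 'n::finite) chart set \<Rightarrow> ('a, 'n) metric \<Rightarrow> bool" where
  "riemannian_metric A g \<longleftrightarrow>
     (\<forall>c\<in>A. (\<forall>i j. smooth_fun_on (chart_image c) (\<lambda>y. g c y $ i $ j)) \<and>
        (\<forall>y\<in>chart_image c. transpose (g c y) = g c y \<and> (\<forall>v. v \<noteq> 0 \<longrightarrow> 0 < v \<bullet> (g c y *v v)))) \<and>
     (\<forall>c\<in>A. \<forall>d\<in>A. \<forall>y\<in>chart_overlap c d.
        let J = jacobian (chart_overlap c d) (transition c d) y
        in g c y = transpose J ** g d (transition c d y) ** J)"


section \<open>Curvature, Hessian and trace in coordinates\<close>

text \<open>
  Here \<open>h\<close> is the component matrix of a metric as a function on a coordinate domain \<open>S\<close>, and
  functions are likewise given in coordinates.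
\<close>

definition christoffel ::
    "(real^'n) set \<Rightarrow> (real^'n \<Rightarrow> real^'n^'n) \<Rightarrow> 'n \<Rightarrow> 'n \<Rightarrow> 'n \<Rightarrow> real^'n \<Rightarrow> real" where
  "christoffel S h k i j y =
     (1/2) * (\<Sum>l\<in>UNIV. matrix_inv (h y) $ k $ l *
        (pd S i (\<lambda>z. h z $ j $ l) y + pd S j (\<lambda>z. h z $ i $ l) y - pd S l (\<lambda>z. h z $ i $ j) y))"

text \<open>The sign is such that round spheres have positive Ricci curvature.\<close>

definition ricci :: "(real^'n) set \<Rightarrow> (real^'n \<Rightarrow> real^'n^'n) \<Rightarrow> real^'n \<Rightarrow> real^'n^'n" where
  "ricci S h y = (\<chi> i j.
     (\<Sum>k\<in>UNIV. pd S k (christoffel S h k i j) y - pd S j (christoffel S h k i k) y) +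
     (\<Sum>k\<in>UNIV. \<Sum>l\<in>UNIV. christoffel S h k k l y * christoffel S h l i j y
                     - christoffel S h k j l y * christoffel S h l i k y))"

definition trace_wrt :: "real^'n^'n \<Rightarrow> real^'n^'n \<Rightarrow> real" where
  "trace_wrt G B = (\<Sum>i\<in>UNIV. \<Sum>j\<in>UNIV. matrix_inv G $ i $ j * B $ i $ j)"

definition einstein :: "(real^'n) set \<Rightarrow> (real^'n \<Rightarrow> real^'n^'n) \<Rightarrow> real^'n \<Rightarrow> real^'n^'n" where
  "einstein S h y = ricci S h y - ((1/2) * trace_wrt (h y) (ricci S h y)) *\<^sub>R h y"

definition differential :: "(real^'n) set \<Rightarrow> (real^'n \<Rightarrow> real) \<Rightarrow> real^'n \<Rightarrow> real^'n" where
  "differential S w y = (\<chi> i. pd S i w y)"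

definition hessian ::
    "(real^'n) set \<Rightarrow> (real^'n \<Rightarrow> real^'n^'n) \<Rightarrow> (real^'n \<Rightarrow> real) \<Rightarrow> real^'n \<Rightarrow> real^'n^'n" where
  "hessian S h w y = (\<chi> i j.
     pd S i (pd S j w) y - (\<Sum>k\<in>UNIV. christoffel S h k i j y * pd S k w y))"

text \<open>\<open>|\<nabla>w|\<^sup>2\<close> with respect to \<open>G\<close>, in terms of the covector \<open>p = dw\<close>.\<close>

definition norm_sq_wrt :: "real^'n^'n \<Rightarrow> real^'n \<Rightarrow> real" where
  "norm_sq_wrt G p = (\<Sum>i\<in>UNIV. \<Sum>j\<in>UNIV. matrix_inv G $ i $ j * p $ i * p $ j)"

definition conformal_metric :: "('a \<Rightarrow> real) \<Rightarrow> ('a, 'n::finite) metric \<Rightarrow> ('a, 'n) metric" where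
  "conformal_metric u g c y = exp (2 * u (chart_point c y)) *\<^sub>R g c y"


section \<open>Eigenvalues\<close>

text \<open>
  The eigenvalues of \<open>B\<close> with respect to \<open>G\<close>, with multiplicity, are the roots of
  \<open>det (B - t G)\<close>. For symmetric \<open>B\<close> and positive definite \<open>G\<close> the vector below exists and is
  unique up to the order of its entries; it is only used in ways that do not depend on the order.
\<close>

definition eigenvalues :: "real^'n^'n \<Rightarrow> real^'n^'n \<Rightarrow> real^'n" where
  "eigenvalues G B = (SOME v. \<forall>t. det (B - t *\<^sub>R G) = det G * (\<Prod>i\<in>UNIV. v $ i - t))"


section \<open>Second order equations and uniform ellipticity\<close>

text \<open>
  An operator \<open>\<Phi>(x, u, du, \<nabla>\<^sup>2u)\<close> is written in charts: the arguments are the chart, the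
  coordinates of \<open>x\<close>, and the components of the value, the differential and the Hessian.
\<close>

type_synonym ('a, 'n) operator2 =
  "('a, 'n) chart \<Rightarrow> real^'n \<Rightarrow> real \<Rightarrow> real^'n \<Rightarrow> real^'n^'n \<Rightarrow> real"

abbreviation value_at :: "('a, 'n::finite) chart \<Rightarrow> ('a \<Rightarrow> real) \<Rightarrow> real^'n \<Rightarrow> real" where
  "value_at c u y \<equiv> u (chart_point c y)"

abbreviation differential_at :: "('a, 'n::finite) chart \<Rightarrow> ('a \<Rightarrow> real) \<Rightarrow> real^'n \<Rightarrow> real^'n" where
  "differential_at c u y \<equiv> differential (chart_image c) (u \<circ> chart_point c) y"

abbreviation hessian_at ::
    "('a, 'n::finite) metric \<Rightarrow> ('a, 'n) chart \<Rightarrow> ('a \<Rightarrow> real) \<Rightarrow> real^'n \<Rightarrow> real^'n^'n" where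
  "hessian_at g c u y \<equiv> hessian (chart_image c) (g c) (u \<circ> chart_point c) y"

text \<open>
  \<open>a\<close> is \<open>\<partial>F/\<partial>H\<^sub>i\<^sub>j\<close> for a function \<open>F\<close> of symmetric matrices, normalised as usual to be
  symmetric.
\<close>

definition hessian_coefficients ::
    "(real^'n^'n \<Rightarrow> real) \<Rightarrow> real^'n^'n \<Rightarrow> real^'n^'n \<Rightarrow> bool" where
  "hessian_coefficients F H a \<longleftrightarrow> transpose a = a \<and>
     (F has_derivative (\<lambda>K. \<Sum>i\<in>UNIV. \<Sum>j\<in>UNIV. a $ i $ j * K $ i $ j)) (at H within {K. transpose K = K})"

text \<open>
  Since \<open>a\<^sup>i\<^sup>j\<close> has upper indices, its eigenvalues with respect to \<open>g\<close> are taken relative to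
  \<open>g\<^sup>i\<^sup>j\<close>. The bijection \<open>e\<close> lists them in decreasing order as \<open>\<alpha> $ e 1, \<dots>, \<alpha> $ e n\<close>.
\<close>

definition k_uniformly_elliptic ::
    "nat \<Rightarrow> ('a, 'n::finite) chart set \<Rightarrow> ('a, 'n) metric \<Rightarrow> ('a, 'n) operator2 \<Rightarrow> ('a \<Rightarrow> real) set \<Rightarrow> bool" where
  "k_uniformly_elliptic k A g \<Phi> C \<longleftrightarrow>
     (\<exists>\<theta>>0. \<forall>u\<in>C. \<forall>c\<in>A. \<forall>y\<in>chart_image c. \<exists>a.
        hessian_coefficients (\<Phi> c y (value_at c u y) (differential_at c u y)) (hessian_at g c u y) a \<and>
        (let \<alpha> = eigenvalues (matrix_inv (g c y)) a in
         \<exists>e. bij_betw e {1..CARD('n)} (UNIV :: 'n set) \<and>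
             (\<forall>i\<in>{1..CARD('n)}. \<forall>j\<in>{i..CARD('n)}. \<alpha> $ e j \<le> \<alpha> $ e i) \<and>
             (\<forall>i\<in>{1..CARD('n)}. 0 \<le> \<alpha> $ e i) \<and>
             0 < (\<Sum>j=1..CARD('n). \<alpha> $ e j) \<and>
             (\<forall>i\<in>{1..k}. \<theta> * (\<Sum>j=1..CARD('n). \<alpha> $ e j) \<le> \<alpha> $ e i)))"

definition fully_uniformly_elliptic ::
    "('a, 'n::finite) chart set \<Rightarrow> ('a, 'n) metric \<Rightarrow> ('a, 'n) operator2 \<Rightarrow> ('a \<Rightarrow> real) set \<Rightarrow> bool" where
  "fully_uniformly_elliptic A g \<Phi> C \<longleftrightarrow> k_uniformly_elliptic CARD('n) A g \<Phi> C"


section \<open>The cone and the nonlinearity\<close>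

definition Gamma_n :: "(real^'n) set" where
  "Gamma_n = {v. \<forall>i. 0 < v $ i}"

definition Gamma_1 :: "(real^'n) set" where
  "Gamma_1 = {v. 0 < (\<Sum>i\<in>UNIV. v $ i)}"

definition permute_vec :: "('n \<Rightarrow> 'n) \<Rightarrow> real^'n \<Rightarrow> real^'n" where
  "permute_vec \<pi> v = (\<chi> i. v $ \<pi> i)"

text \<open>Scaling is by positive factors only: an open proper cone does not contain its vertex.\<close>

definition admissible_cone :: "(real^'n) set \<Rightarrow> bool" where
  "admissible_cone \<Gamma> \<longleftrightarrow>
     open \<Gamma> \<and> convex \<Gamma> \<and> (\<forall>v\<in>\<Gamma>. \<forall>t>0. t *\<^sub>R v \<in> \<Gamma>) \<and>
     (\<forall>\<pi>. bij \<pi> \<longrightarrow> (\<forall>v\<in>\<Gamma>. permute_vec \<pi> v \<in> \<Gamma>)) \<and>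
     frontier \<Gamma> \<noteq> {} \<and> Gamma_n \<subseteq> \<Gamma> \<and> \<Gamma> \<subseteq> Gamma_1"

definition sup_on :: "(real^'n) set \<Rightarrow> (real^'n \<Rightarrow> real) \<Rightarrow> ereal" where
  "sup_on \<Gamma> f = (SUP v\<in>\<Gamma>. ereal (f v))"

definition admissible_function :: "(real^'n) set \<Rightarrow> (real^'n \<Rightarrow> real) \<Rightarrow> bool" where
  "admissible_function \<Gamma> f \<longleftrightarrow>
     smooth_fun_on \<Gamma> f \<and> concave_on \<Gamma> f \<and>
     (\<forall>\<pi>. bij \<pi> \<longrightarrow> (\<forall>v\<in>\<Gamma>. f (permute_vec \<pi> v) = f v)) \<and>
     (\<forall>\<sigma>::real. ereal \<sigma> < sup_on \<Gamma> f \<longrightarrow>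
        (\<forall>v\<in>\<Gamma>. \<exists>L::ereal. ((\<lambda>t. ereal (f (t *\<^sub>R v))) \<longlongrightarrow> L) at_top \<and> ereal \<sigma> < L))"


section \<open>The equation\<close>

text \<open>
  The argument of \<open>\<lambda>\<close> on the left side of the equation, with \<open>p\<close> and \<open>H\<close> in place of \<open>du\<close> and
  \<open>\<nabla>\<^sup>2u\<close>.
\<close>

definition equation_tensor ::
    "('a, 'n::finite) metric \<Rightarrow> ('a, 'n) chart \<Rightarrow> real^'n \<Rightarrow> real^'n \<Rightarrow> real^'n^'n \<Rightarrow> real^'n^'n" where
  "equation_tensor g c y p H =
     trace_wrt (g c y) H *\<^sub>R g c y - H
     + (1 / (real CARD('n) - 2)) *\<^sub>R einstein (chart_image c) (g c) y
     + ((real CARD('n) - 3) / 2 * norm_sq_wrt (g c y) p) *\<^sub>R g c y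
     + (\<chi> i j. p $ i * p $ j)"

definition equation_rhs ::
    "('a \<Rightarrow> real) \<Rightarrow> ('a, 'n::finite) chart \<Rightarrow> real^'n \<Rightarrow> real \<Rightarrow> real" where
  "equation_rhs \<psi> c y z = \<psi> (chart_point c y) * exp (2 * z) / (real CARD('n) - 2)"

definition equation_operator ::
    "('a, 'n::finite) metric \<Rightarrow> (real^'n \<Rightarrow> real) \<Rightarrow> ('a \<Rightarrow> real) \<Rightarrow> ('a, 'n) operator2" where
  "equation_operator g f \<psi> c y z p H =
     f (eigenvalues (g c y) (equation_tensor g c y p H)) - equation_rhs \<psi> c y z"

text \<open>
  As \<open>f\<close> is only defined on \<open>\<Gamma>\<close>, being a solution includes that the argument of \<open>f\<close> lies
  in \<open>\<Gamma>\<close>.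
\<close>

definition is_solution ::
    "('a, 'n::finite) chart set \<Rightarrow> ('a, 'n) metric \<Rightarrow> (real^'n) set \<Rightarrow> (real^'n \<Rightarrow> real) \<Rightarrow>
     ('a \<Rightarrow> real) \<Rightarrow> ('a \<Rightarrow> real) \<Rightarrow> bool" where
  "is_solution A g \<Gamma> f \<psi> u \<longleftrightarrow> Ck_fun 2 A u \<and>
     (\<forall>c\<in>A. \<forall>y\<in>chart_image c.
        eigenvalues (g c y) (equation_tensor g c y (differential_at c u y) (hessian_at g c u y)) \<in> \<Gamma> \<and>
        equation_operator g f \<psi> c y (value_at c u y) (differential_at c u y) (hessian_at g c u y) = 0)"

definition einstein_admissible ::
    "('a, 'n::finite) chart set \<Rightarrow> ('a, 'n) metric \<Rightarrow> (real^'n) set \<Rightarrow> ('a \<Rightarrow> real) \<Rightarrow> bool" where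
  "einstein_admissible A g \<Gamma> u \<longleftrightarrow>
     (\<forall>c\<in>A. \<forall>y\<in>chart_image c.
        eigenvalues (g c y) (einstein (chart_image c) (conformal_metric u g c) y) \<in> \<Gamma>)"

text \<open>
  The right side stays below \<open>sup f\<close>. This is automatic if \<open>f\<close> does not attain its supremum.
  Where the right side equals \<open>sup f\<close>, \<open>f\<close> has an interior maximum at the eigenvalues, so all
  \<open>a\<^sup>i\<^sup>j\<close> vanish and no ellipticity is possible.
\<close>

definition rhs_below_sup ::
    "('a, 'n::finite) chart set \<Rightarrow> (real^'n) set \<Rightarrow> (real^'n \<Rightarrow> real) \<Rightarrow> ('a \<Rightarrow> real) \<Rightarrow> ('a \<Rightarrow> real) \<Rightarrow> bool" where
  "rhs_below_sup A \<Gamma> f \<psi> u \<longleftrightarrow>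
     (\<forall>c\<in>A. \<forall>y\<in>chart_image c. ereal (equation_rhs \<psi> c y (value_at c u y)) < sup_on \<Gamma> f)"

end

theory Submission
  imports Defs
begin

text \<open>
  In a frame that is orthonormal for \<open>g\<close> and diagonalises the tensor in the equation, with
  eigenvalues \<open>w \<in> \<Gamma>\<close>, the linearisation has the eigenvalues
  \<open>\<alpha>\<^sub>i = \<Sum>\<^sub>k q\<^sub>k - q\<^sub>i\<close>, where \<open>q\<close> is the gradient of \<open>f\<close> at \<open>w\<close>. By concavity, the growth of
  \<open>f\<close> along rays forces \<open>q \<bullet> \<mu> > 0\<close> for all \<open>\<mu> \<in> \<Gamma>\<close>, as \<open>f w < sup f\<close>. So all \<open>q\<^sub>i\<close> are
  nonnegative with positive sum. If \<open>\<Gamma> \<noteq> \<Gamma>\<^sub>n\<close>, testing with the permutations of one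
  \<open>\<mu> \<in> \<Gamma>\<close> that has a negative entry shows that no \<open>q\<^sub>i\<close> carries almost all of \<open>\<Sum>\<^sub>k q\<^sub>k\<close>. If
  \<open>\<Gamma> = \<Gamma>\<^sub>n\<close>, at most one \<open>q\<^sub>i\<close> exceeds half of it.

  That \<open>X \<mapsto> f (\<lambda>(X))\<close> is differentiable follows from its concavity in a quantitative form:
  with \<open>W\<close> and \<open>V\<close> the candidate gradients at \<open>B\<close> and \<open>X\<close>, both
  \<open>f (\<lambda>(X)) \<le> f (\<lambda>(B)) + W \<bullet> (X - B)\<close> and the same with \<open>X\<close> and \<open>B\<close> exchanged hold, and \<open>V\<close> tends
  to \<open>W\<close> as \<open>X\<close> tends to \<open>B\<close>.
\<close>

section \<open>Rearrangement for doubly stochastic matrices\<close>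

text \<open>The best pairing is built greedily: the largest \<open>a i\<close> meets the smallest
  \<open>x j\<close>, after which one row and one column are deleted. This replaces the
  decomposition of a doubly stochastic matrix into permutation matrices.\<close>

lemma doubly_stochastic_permutation_bound:
  fixes P :: "'i \<Rightarrow> 'i \<Rightarrow> real" and a x :: "'i \<Rightarrow> real"
  assumes "finite I" "finite J" "card I = card J"
    and nonneg: "\<And>i j. i \<in> I \<Longrightarrow> j \<in> J \<Longrightarrow> 0 \<le> P i j"
    and rows: "\<And>i. i \<in> I \<Longrightarrow> (\<Sum>j\<in>J. P i j) = 1"
    and cols: "\<And>j. j \<in> J \<Longrightarrow> (\<Sum>i\<in>I. P i j) = 1"
  obtains \<pi> where "bij_betw \<pi> I J" "(\<Sum>i\<in>I. a i * x (\<pi> i)) \<le> (\<Sum>i\<in>I. \<Sum>j\<in>J. a i * P i j * x j)"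
proof -
  have "\<exists>\<pi>. bij_betw \<pi> I J \<and> (\<Sum>i\<in>I. a i * x (\<pi> i)) \<le> (\<Sum>i\<in>I. \<Sum>j\<in>J. a i * P i j * x j)"
    using assms
  proof (induction "card I" arbitrary: I J P)
    case 0
    then show ?case by (auto simp: bij_betw_def)
  next
    case (Suc m)
    have ne: "I \<noteq> {}" "J \<noteq> {}" using Suc.hyps(2) Suc.prems(3) by auto
    obtain i0 where i0: "i0 \<in> I" "\<And>i. i \<in> I \<Longrightarrow> a i \<le> a i0"
      using Suc.prems(1) ne(1) Max_in[of "a ` I"] by (metis (no_types, lifting) Max_ge finite_imageI imageE imageI image_is_empty)
    obtain j0 where j0: "j0 \<in> J" "\<And>j. j \<in> J \<Longrightarrow> x j0 \<le> x j"
      using Suc.prems(2) ne(2) arg_min_if_finite[of J x] by (metis not_less)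
    define p where "p = P i0 j0"
    define I' where "I' = I - {i0}"
    define J' where "J' = J - {j0}"
    have fin: "finite I'" "finite J'" using Suc.prems by (auto simp: I'_def J'_def)
    have I: "I = insert i0 I'" "i0 \<notin> I'" and J: "J = insert j0 J'" "j0 \<notin> J'"
      using i0 j0 by (auto simp: I'_def J'_def)
    \<comment> \<open>Move mass so that \<open>(i0, j0)\<close> gets the weight 1: since \<open>a i0\<close> is largest and \<open>x j0\<close> smallest, this
      does not increase the right side. For \<open>p = 1\<close> nothing moves, as \<open>d\<close> is then \<open>0\<close>.\<close>
    define d where "d i j = P i j0 * P i0 j / (1 - p)" for i j
    define P' where "P' i j = P i j + d i j" for i j
    have nn: "0 \<le> P i j" if "i \<in> I" "j \<in> J" for i j using Suc.prems(4) that .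
    have row0: "(\<Sum>j\<in>J'. P i0 j) = 1 - p"
      using Suc.prems(5)[of i0] i0(1) fin J by (simp add: p_def)
    have col0: "(\<Sum>i\<in>I'. P i j0) = 1 - p"
      using Suc.prems(6)[of j0] j0(1) fin I by (simp add: p_def)
    have p1: "p \<le> 1" using row0 sum_nonneg[of J' "P i0"] nn i0 J by force
    have zc: "P i j0 = 0" if "p = 1" "i \<in> I'" for i
      using that col0 fin nn j0 I by (simp add: sum_nonneg_eq_0_iff)
    have zr: "P i0 j = 0" if "p = 1" "j \<in> J'" for j
      using that row0 fin nn i0 J by (simp add: sum_nonneg_eq_0_iff)
    \<comment> \<open>The correction \<open>d\<close> has rank one. Its row sums make up for the
      deleted column \<open>j0\<close> and its column sums for the deleted row \<open>i0\<close>, so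
      \<open>P'\<close> is doubly stochastic on what remains.\<close>
    have drow: "(\<Sum>j\<in>J'. d i j) = P i j0" if "i \<in> I'" for i
    proof (cases "p = 1")
      case True then show ?thesis using zc that by (simp add: d_def)
    next
      case False
      have "(\<Sum>j\<in>J'. d i j) = P i j0 * (\<Sum>j\<in>J'. P i0 j) / (1 - p)"
        by (simp add: d_def sum_distrib_left sum_divide_distrib)
      then show ?thesis using False row0 by simp
    qed
    have dcol: "(\<Sum>i\<in>I'. d i j) = P i0 j" if "j \<in> J'" for j
    proof (cases "p = 1")
      case True then show ?thesis using zr that by (simp add: d_def)
    next
      case False
      have "(\<Sum>i\<in>I'. d i j) = (\<Sum>i\<in>I'. P i j0) * P i0 j / (1 - p)"
        by (simp add: d_def sum_distrib_right sum_divide_distrib)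
      then show ?thesis using False col0 by simp
    qed
    have d0: "0 \<le> d i j" if "i \<in> I'" "j \<in> J'" for i j
      using that nn i0 j0 I J p1 by (simp add: d_def)
    have "\<exists>\<pi>. bij_betw \<pi> I' J' \<and> (\<Sum>i\<in>I'. a i * x (\<pi> i)) \<le> (\<Sum>i\<in>I'. \<Sum>j\<in>J'. a i * P' i j * x j)"
    proof (rule Suc.hyps(1))
      show "m = card I'" using Suc.hyps(2) Suc.prems(1) i0 by (simp add: I'_def)
      show "card I' = card J'" using Suc.prems i0 j0 by (simp add: I'_def J'_def)
      show "0 \<le> P' i j" if "i \<in> I'" "j \<in> J'" for i j
        using d0 that nn I J by (simp add: P'_def)
      show "(\<Sum>j\<in>J'. P' i j) = 1" if "i \<in> I'" for i
        using Suc.prems(5)[of i] that drow fin I J by (simp add: P'_def sum.distrib)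
      show "(\<Sum>i\<in>I'. P' i j) = 1" if "j \<in> J'" for j
        using Suc.prems(6)[of j] that dcol fin I J by (simp add: P'_def sum.distrib)
    qed (use fin in auto)
    then obtain \<pi> where \<pi>: "bij_betw \<pi> I' J'"
      "(\<Sum>i\<in>I'. a i * x (\<pi> i)) \<le> (\<Sum>i\<in>I'. \<Sum>j\<in>J'. a i * P' i j * x j)" by blast
    define \<rho> where "\<rho> = \<pi>(i0 := j0)"
    have "bij_betw \<rho> I J"
      unfolding \<rho>_def I(1) J(1)
      using \<pi>(1) I(2) J(2) by (auto simp: bij_betw_def inj_on_def)
    moreover have "(\<Sum>i\<in>I. a i * x (\<rho> i)) \<le> (\<Sum>i\<in>I. \<Sum>j\<in>J. a i * P i j * x j)"
    proof -
      have "(\<Sum>i\<in>I. a i * x (\<rho> i)) = a i0 * x j0 + (\<Sum>i\<in>I'. a i * x (\<pi> i))"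
        using fin I by (auto simp: \<rho>_def intro!: sum.cong)
      also have "\<dots> \<le> a i0 * x j0 + (\<Sum>i\<in>I'. \<Sum>j\<in>J'. a i * P' i j * x j)"
        using \<pi>(2) by simp
      also have "\<dots> \<le> (\<Sum>i\<in>I. \<Sum>j\<in>J. a i * P i j * x j)"
      proof -
        \<comment> \<open>This sum is exactly the gain: shifting the mass \<open>d i j\<close> from
          \<open>(i0, j)\<close> and \<open>(i, j0)\<close> to \<open>(i, j)\<close> and
          \<open>(i0, j0)\<close> lowers the right side by
          \<open>d i j * ((a i0 - a i) * (x j - x j0))\<close>.\<close>
        have "0 \<le> (\<Sum>i\<in>I'. \<Sum>j\<in>J'. d i j * ((a i0 - a i) * (x j - x j0)))"
          using i0 j0 d0 I J by (intro sum_nonneg mult_nonneg_nonneg) auto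
        also have "\<dots> = (\<Sum>i\<in>I'. \<Sum>j\<in>J'. a i0 * (d i j * x j) - a i * d i j * x j
              - a i0 * x j0 * d i j + a i * x j0 * d i j)"
          by (simp add: algebra_simps)
        also have "\<dots> = (\<Sum>i\<in>I'. \<Sum>j\<in>J'. a i0 * (d i j * x j)) - (\<Sum>i\<in>I'. \<Sum>j\<in>J'. a i * d i j * x j)
              - a i0 * x j0 * (\<Sum>i\<in>I'. \<Sum>j\<in>J'. d i j) + (\<Sum>i\<in>I'. a i * x j0 * (\<Sum>j\<in>J'. d i j))"
          by (simp add: sum.distrib sum_subtractf sum_distrib_left)
        also have "(\<Sum>i\<in>I'. \<Sum>j\<in>J'. a i0 * (d i j * x j)) = (\<Sum>j\<in>J'. a i0 * ((\<Sum>i\<in>I'. d i j) * x j))"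
          by (subst sum.swap) (simp add: sum_distrib_left sum_distrib_right)
        also have "\<dots> = (\<Sum>j\<in>J'. a i0 * P i0 j * x j)"
          using dcol by (intro sum.cong) auto
        also have "(\<Sum>i\<in>I'. \<Sum>j\<in>J'. d i j) = 1 - p"
          using drow col0 by simp
        also have "(\<Sum>i\<in>I'. a i * x j0 * (\<Sum>j\<in>J'. d i j)) = (\<Sum>i\<in>I'. a i * P i j0 * x j0)"
          using drow by (intro sum.cong) auto
        finally have *: "0 \<le> (\<Sum>j\<in>J'. a i0 * P i0 j * x j) - (\<Sum>i\<in>I'. \<Sum>j\<in>J'. a i * d i j * x j)
            - a i0 * x j0 * (1 - p) + (\<Sum>i\<in>I'. a i * P i j0 * x j0)" .
        have "(\<Sum>i\<in>I. \<Sum>j\<in>J. a i * P i j * x j) =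
            a i0 * p * x j0 + (\<Sum>j\<in>J'. a i0 * P i0 j * x j) + (\<Sum>i\<in>I'. a i * P i j0 * x j0)
             + (\<Sum>i\<in>I'. \<Sum>j\<in>J'. a i * P i j * x j)"
          using fin I J by (simp add: sum.distrib p_def)
        moreover have "(\<Sum>i\<in>I'. \<Sum>j\<in>J'. a i * P' i j * x j) =
           (\<Sum>i\<in>I'. \<Sum>j\<in>J'. a i * P i j * x j) + (\<Sum>i\<in>I'. \<Sum>j\<in>J'. a i * d i j * x j)"
          by (simp add: P'_def algebra_simps sum.distrib)
        ultimately show ?thesis using * by (simp add: algebra_simps)
      qed
      finally show ?thesis .
    qed
    ultimately show ?case by blast
  qed
  with that show ?thesis by blast
qed

section \<open>Diagonalisation and eigenvalues\<close>

text \<open>By compactness the quadratic form has a maximiser on the unit sphere of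
  \<open>V\<close>. As \<open>V\<close> is invariant, the residual of the eigenvalue equation is an
  admissible direction of variation, so it must vanish.\<close>

lemma invariant_subspace_eigenvector:
  fixes f :: "'a::euclidean_space \<Rightarrow> 'a"
  assumes f: "linear f" and selfadj: "\<And>x y. f x \<bullet> y = x \<bullet> f y"
    and V: "subspace V" and inv: "\<And>x. x \<in> V \<Longrightarrow> f x \<in> V" and nz: "V \<noteq> {0}"
  obtains v \<mu> where "v \<in> V" "norm v = 1" "f v = \<mu> *\<^sub>R v"
proof -
  define S where "S = V \<inter> sphere 0 1"
  have lin: "bounded_linear f" using f by (simp add: linear_linear)
  have "compact S" unfolding S_def
    by (rule closed_Int_compact[OF closed_subspace[OF V] compact_sphere])
  moreover have "S \<noteq> {}"
  proof -
    obtain w where "w \<in> V" "w \<noteq> 0" using nz V subspace_0 by blast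
    then have "w /\<^sub>R norm w \<in> S" using V by (simp add: S_def subspace_scale)
    then show ?thesis by blast
  qed
  moreover have "continuous_on S (\<lambda>x. x \<bullet> f x)"
    by (intro continuous_intros linear_continuous_on lin)
  ultimately obtain v where v: "v \<in> S" "\<And>x. x \<in> S \<Longrightarrow> x \<bullet> f x \<le> v \<bullet> f v"
    using continuous_attains_sup by metis
  define \<mu> where "\<mu> = v \<bullet> f v"
  have vV: "v \<in> V" "norm v = 1" using v by (auto simp: S_def)
  have max: "x \<bullet> f x \<le> \<mu> * (x \<bullet> x)" if "x \<in> V" for x
  proof (cases "x = 0")
    case False
    then have "x /\<^sub>R norm x \<in> S" using V that by (simp add: S_def subspace_scale)
    from v(2)[OF this] have "(x \<bullet> f x) / (norm x)^2 \<le> \<mu>"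
      using f by (simp add: \<mu>_def linear_cmul divide_inverse power2_eq_square mult_ac)
    then show ?thesis using False by (simp add: divide_le_eq power2_norm_eq_inner)
  qed (use f in simp)
  have vv: "v \<bullet> v = 1" using vV(2) by (simp add: norm_eq_1)
  define w where "w = f v - \<mu> *\<^sub>R v"
  have wV: "w \<in> V" using V inv vV by (simp add: w_def subspace_diff subspace_scale)
  have wv: "w \<bullet> v = 0" by (simp add: w_def inner_diff_left inner_diff_right \<mu>_def vv inner_commute)
  have wf: "w \<bullet> f v = w \<bullet> w"
    using wv by (simp add: w_def inner_diff_right inner_diff_left inner_commute)
  \<comment> \<open>First variation at the maximum of the Rayleigh quotient in the direction of the residual.\<close>
  have "w \<bullet> w = 0"
  proof (rule ccontr)
    assume "w \<bullet> w \<noteq> 0"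
    then have ww: "w \<bullet> w > 0" by (metis inner_ge_zero less_eq_real_def)
    have ineq: "2 * t * (w \<bullet> w) \<le> t^2 * (\<mu> * (w \<bullet> w) - w \<bullet> f w)" for t :: real
    proof -
      have "(v + t *\<^sub>R w) \<bullet> f (v + t *\<^sub>R w) \<le> \<mu> * ((v + t *\<^sub>R w) \<bullet> (v + t *\<^sub>R w))"
        using V vV wV by (intro max) (simp add: subspace_add subspace_scale)
      moreover have "(v + t *\<^sub>R w) \<bullet> f (v + t *\<^sub>R w) = \<mu> + 2 * t * (w \<bullet> w) + t^2 * (w \<bullet> f w)"
        using selfadj[of v w] wf f
        by (simp add: linear_add linear_cmul inner_add_left inner_add_right \<mu>_def power2_eq_square
            algebra_simps inner_commute)
      moreover have "(v + t *\<^sub>R w) \<bullet> (v + t *\<^sub>R w) = 1 + t^2 * (w \<bullet> w)"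
        using wv vv by (simp add: inner_add_left inner_add_right power2_eq_square inner_commute)
      ultimately have "\<mu> + 2 * t * (w \<bullet> w) + t^2 * (w \<bullet> f w) \<le> \<mu> * (1 + t^2 * (w \<bullet> w))"
        by (simp only:)
      then show ?thesis by (simp add: algebra_simps)
    qed
    define C where "C = \<bar>\<mu> * (w \<bullet> w) - w \<bullet> f w\<bar> + 1"
    have C: "C > 0" "\<mu> * (w \<bullet> w) - w \<bullet> f w \<le> C" by (auto simp: C_def)
    \<comment> \<open>With this \<open>t\<close> the quadratic term is at most
      \<open>t * (w \<bullet> w)\<close>, half of the linear term, which is impossible. The summand
      1 in \<open>C\<close> keeps the denominator positive.\<close>
    define t where "t = (w \<bullet> w) / C"
    have t: "t > 0" "t * C = w \<bullet> w" using ww C by (auto simp: t_def)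
    have "2 * t * (w \<bullet> w) \<le> t^2 * C"
      using ineq[of t] C(2) by (smt (verit) mult_left_mono zero_le_power2)
    also have "\<dots> = t * (w \<bullet> w)" by (simp add: power2_eq_square flip: t(2))
    finally show False using t(1) ww by (simp add: mult_pos_pos)
  qed
  then have "f v = \<mu> *\<^sub>R v" by (simp add: w_def)
  then show ?thesis using that vV by blast
qed

text \<open>The complement in \<open>V\<close> of one eigenvector is again invariant because
  \<open>f\<close> is self-adjoint, so an orthonormal eigenbasis arises by induction on the
  dimension.\<close>

lemma selfadjoint_eigenbasis:
  fixes f :: "'a::euclidean_space \<Rightarrow> 'a"
  assumes f: "linear f" and selfadj: "\<And>x y. f x \<bullet> y = x \<bullet> f y"
    and V: "subspace V" and inv: "\<And>x. x \<in> V \<Longrightarrow> f x \<in> V"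
  shows "\<exists>B\<subseteq>V. finite B \<and> card B = dim V \<and> pairwise orthogonal B \<and>
            (\<forall>v\<in>B. norm v = 1 \<and> (\<exists>\<mu>. f v = \<mu> *\<^sub>R v))"
  using V inv
proof (induction "dim V" arbitrary: V)
  case 0
  then show ?case by (intro exI[of _ "{}"]) auto
next
  case (Suc m)
  have "V \<noteq> {0}" using Suc.hyps(2) by auto
  then obtain v \<mu> where v: "v \<in> V" "norm v = 1" "f v = \<mu> *\<^sub>R v"
    using invariant_subspace_eigenvector[OF f selfadj Suc.prems] by metis
  define W where "W = {x \<in> V. orthogonal v x}"
  have "subspace W"
    using Suc.prems(1) by (auto simp: W_def subspace_def orthogonal_def inner_add_right)
  moreover have "f x \<in> W" if "x \<in> W" for x
    using that Suc.prems(2) selfadj[of v x] v(3) by (simp add: W_def orthogonal_def)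
  moreover have "dim W = m"
  proof -
    have sp: "span {v} \<subseteq> V" "span {v} = {y. \<exists>k. y = k *\<^sub>R v}"
      using v Suc.prems(1) by (auto simp: span_singleton subspace_scale)
    have "{y \<in> V. \<forall>x \<in> span {v}. orthogonal x y} = W"
      by (auto simp: W_def orthogonal_def sp(2))
    then have "dim W + dim (span {v}) = dim V"
      using dim_subspace_orthogonal_to_vectors[OF subspace_span[of "{v}"] Suc.prems(1) sp(1)] by simp
    moreover have "dim (span {v}) = 1" using v(2) by (auto simp: dim_singleton)
    ultimately show ?thesis using Suc.hyps(2) by simp
  qed
  ultimately obtain B where B: "B \<subseteq> W" "finite B" "card B = dim W" "pairwise orthogonal B"
     "\<forall>v\<in>B. norm v = 1 \<and> (\<exists>\<mu>. f v = \<mu> *\<^sub>R v)"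
    using Suc.hyps(1)[of W] by auto
  have "v \<notin> B" using B(1) v(2) by (auto simp: W_def orthogonal_def norm_eq_1)
  then have "card (insert v B) = dim V" using B \<open>dim W = m\<close> Suc.hyps(2) by simp
  moreover have "pairwise orthogonal (insert v B)"
    using B(1,4) by (auto simp: W_def pairwise_insert orthogonal_commute)
  ultimately show ?case using B v
    by (intro exI[of _ "insert v B"]) (auto simp: W_def)
qed

definition diag_matrix :: "real^'n \<Rightarrow> real^'n^'n" where
  "diag_matrix v = (\<chi> i j. if i = j then v $ i else 0)"

lemma symmetric_diagonalisation:
  fixes X :: "real^'n^'n"
  assumes "transpose X = X"
  obtains Q v where "orthogonal_matrix Q" "X = Q ** diag_matrix v ** transpose Q"
proof -
  have sa: "(X *v x) \<bullet> y = x \<bullet> (X *v y)" for x y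
    using assms by (metis dot_lmul_matrix vector_transpose_matrix)
  obtain B where B: "finite B" "card B = DIM(real^'n)" "pairwise orthogonal B"
    "\<forall>v\<in>B. norm v = 1 \<and> (\<exists>\<mu>. X *v v = \<mu> *\<^sub>R v)"
    using selfadjoint_eigenbasis[of "(*v) X" UNIV] sa by (auto simp: matrix_vector_mul_linear)
  then obtain b :: "'n \<Rightarrow> real^'n" where b: "bij_betw b UNIV B"
    using finite_same_card_bij[of "UNIV :: 'n set" B] by (auto simp: DIM_cart)
  have bn: "norm (b i) = 1" "\<exists>\<mu>. X *v b i = \<mu> *\<^sub>R b i" for i
    using B(4) b by (auto simp: bij_betw_def)
  have bo: "b i \<bullet> b j = (if i = j then 1 else 0)" for i j
    using B(3) b bn(1) unfolding pairwise_def orthogonal_def bij_betw_def inj_on_def norm_eq_1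
    by (metis UNIV_I image_eqI)
  define Q :: "real^'n^'n" where "Q = (\<chi> i j. b j $ i)"
  have "transpose Q ** Q = mat 1"
    using bo by (simp add: Q_def transpose_def matrix_matrix_mult_def mat_def vec_eq_iff inner_vec_def)
  then have Q: "orthogonal_matrix Q" by (simp add: orthogonal_matrix)
  obtain \<mu> where \<mu>: "\<And>i. X *v b i = \<mu> i *\<^sub>R b i" using bn(2) by metis
  define v :: "real^'n" where "v = (\<chi> i. \<mu> i)"
  have "(X ** Q) $ i $ j = (Q ** diag_matrix v) $ i $ j" for i j
  proof -
    have "(X ** Q) $ i $ j = (X *v b j) $ i"
      by (simp add: Q_def matrix_matrix_mult_def matrix_vector_mult_def)
    also have "\<dots> = \<mu> j * b j $ i" using \<mu> by simp
    also have "\<dots> = (Q ** diag_matrix v) $ i $ j"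
      by (simp add: Q_def v_def matrix_matrix_mult_def diag_matrix_def if_distrib
          sum.delta cong: if_cong)
    finally show ?thesis .
  qed
  then have "X ** Q = Q ** diag_matrix v" by (simp add: vec_eq_iff)
  then have "X ** Q ** transpose Q = Q ** diag_matrix v ** transpose Q" by simp
  then have "X = Q ** diag_matrix v ** transpose Q"
    using Q by (simp add: orthogonal_matrix_def flip: matrix_mul_assoc)
  then show ?thesis using that Q by blast
qed

section \<open>Characteristic polynomials and the choice made in \<open>eigenvalues\<close>\<close>

lemma diag_matrix_minus_mat: "diag_matrix v - t *\<^sub>R mat 1 = diag_matrix (v - (\<chi> i. t))"
  by (simp add: diag_matrix_def mat_def vec_eq_iff)

lemma det_diag_matrix: "det (diag_matrix v) = (\<Prod>i\<in>UNIV. v $ i)"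
  by (subst det_diagonal) (auto simp: diag_matrix_def)

text \<open>Up to the sign \<open>(-1)^CARD('n)\<close> both sides are monic polynomials in
  \<open>t\<close>. Agreeing everywhere, they are equal and have the same multiset of roots; vectors
  with equal multisets of entries differ by a permutation of the indices.\<close>

lemma permutation_of_prod_eq:
  fixes v w :: "real^'n"
  assumes "\<And>t. (\<Prod>i\<in>UNIV. v $ i - t) = (\<Prod>i\<in>UNIV. w $ i - t)"
  obtains \<pi> where "bij \<pi>" "w = permute_vec \<pi> v"
proof -
  define p where "p u = (\<Prod>i\<in>UNIV. [:- (u $ i), 1:])" for u :: "real^'n"
  have "poly (p u) t = (\<Prod>i\<in>UNIV. t - u $ i)" for u t
    by (simp add: p_def poly_prod)
  also have "(\<Prod>i\<in>UNIV. t - u $ i) = (-1)^CARD('n) * (\<Prod>i\<in>UNIV. u $ i - t)" for u :: "real^'n" and t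
  proof -
    have "(\<Prod>i\<in>UNIV. t - u $ i) = (\<Prod>i\<in>UNIV. (-1) * (u $ i - t))" by simp
    then show ?thesis by (simp only: prod.distrib prod_constant)
  qed
  finally have "poly (p v) = poly (p w)" using assms by (simp add: fun_eq_iff)
  then have "p v = p w" using poly_eq_poly_eq_iff by blast
  moreover have "proots (p u) = image_mset (\<lambda>i. u $ i) (mset_set UNIV)" for u
  proof -
    have "proots (p u) = (\<Sum>i\<in>UNIV. {#u $ i#})"
      unfolding p_def by (subst proots_prod) auto
    also have "\<dots> = image_mset (\<lambda>i. u $ i) (mset_set UNIV)"
      by (simp add: sum_unfold_sum_mset)
    finally show ?thesis .
  qed
  ultimately have "image_mset (\<lambda>i. w $ i) (mset_set UNIV) = image_mset (\<lambda>i. v $ i) (mset_set UNIV)"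
    by metis
  from image_mset_eq_implies_permutes[OF _ this] obtain \<pi>
    where "\<pi> permutes UNIV" "\<forall>i. w $ i = v $ \<pi> i" by auto
  then show ?thesis
    using that[of \<pi>] by (auto simp: permute_vec_def vec_eq_iff permutes_bij)
qed

text \<open>A congruence multiplies both sides of the equation that defines
  \<open>eigenvalues\<close> by the nonzero factor \<open>(det E)^2\<close>. Both choices are made
  from the same set of vectors, so they are equal as vectors and not merely up to order.\<close>

lemma eigenvalues_congruence:
  assumes "invertible E" "transpose E ** G ** E = G'" "transpose E ** B ** E = B'"
  shows "eigenvalues G B = eigenvalues G' B'"
proof -
  have E: "det E \<noteq> 0" using assms(1) by (simp add: invertible_det_nz)
  have "det (B' - t *\<^sub>R G') = (det E)^2 * det (B - t *\<^sub>R G)" for t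
  proof -
    have "B' - t *\<^sub>R G' = transpose E ** (B - t *\<^sub>R G) ** E"
      unfolding assms(2,3)[symmetric]
      by (simp add: matrix_matrix_mult_def vec_eq_iff sum_subtractf sum_distrib_left sum_distrib_right algebra_simps)
    then show ?thesis by (simp add: det_mul power2_eq_square)
  qed
  moreover have "det G' = (det E)^2 * det G"
    unfolding assms(2)[symmetric] by (simp add: det_mul power2_eq_square)
  ultimately show ?thesis using E by (simp add: eigenvalues_def mult.assoc)
qed

lemma orthogonal_transpose_mult:
  assumes "orthogonal_matrix Q"
  shows "transpose Q ** Q = mat 1" "Q ** transpose Q = mat 1"
  using assms by (auto simp: orthogonal_matrix_def)

lemma eigenvalues_diagonalised:
  fixes X :: "real^'n^'n"
  assumes "orthogonal_matrix Q" "X = Q ** diag_matrix v ** transpose Q"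
  obtains \<pi> where "bij \<pi>" "eigenvalues (mat 1) X = permute_vec \<pi> v"
proof -
  note Q = orthogonal_transpose_mult[OF assms(1)]
  have "transpose Q ** X ** Q = (transpose Q ** Q) ** diag_matrix v ** (transpose Q ** Q)"
    unfolding assms(2) by (simp only: matrix_mul_assoc)
  then have "transpose Q ** X ** Q = diag_matrix v" by (simp add: Q)
  moreover have "invertible Q" using Q unfolding invertible_def by blast
  ultimately have "eigenvalues (mat 1) X = eigenvalues (mat 1) (diag_matrix v)"
    using Q by (intro eigenvalues_congruence[of Q]) auto
  \<comment> \<open>The choice in \<open>eigenvalues\<close> satisfies its equation because
    \<open>v\<close> does; it may list the entries of \<open>v\<close> in another order.\<close>
  moreover have "\<forall>t. det (diag_matrix v - t *\<^sub>R mat 1) = det (mat 1 :: real^'n^'n) * (\<Prod>i\<in>UNIV. w $ i - t)"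
    if "w = eigenvalues (mat 1) (diag_matrix v)" for w :: "real^'n"
    unfolding that eigenvalues_def
    by (rule someI[of _ v]) (simp add: diag_matrix_minus_mat det_diag_matrix)
  ultimately have "(\<Prod>i\<in>UNIV. v $ i - t) = (\<Prod>i\<in>UNIV. eigenvalues (mat 1) X $ i - t)" for t
    by (simp add: diag_matrix_minus_mat det_diag_matrix)
  then show ?thesis using permutation_of_prod_eq that by blast
qed

section \<open>Symmetric concave functions of the eigenvalues\<close>

lemma inner_matrix_eq_trace: "A \<bullet> B = trace (transpose A ** B)" for A B :: "real^'n^'n"
proof -
  have "A \<bullet> B = (\<Sum>i\<in>UNIV. \<Sum>j\<in>UNIV. A $ j $ i * B $ j $ i)"
    unfolding inner_vec_def by (simp add: inner_vec_def) (rule sum.swap)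
  then show ?thesis by (simp add: trace_def matrix_matrix_mult_def transpose_def)
qed

lemma inner_congruence:
  fixes A B Q :: "real^'n^'n"
  shows "(Q ** A ** transpose Q) \<bullet> B = A \<bullet> (transpose Q ** B ** Q)"
proof -
  have "(Q ** A ** transpose Q) \<bullet> B = trace (Q ** (transpose A ** transpose Q ** B))"
    by (simp add: inner_matrix_eq_trace matrix_transpose_mul matrix_mul_assoc)
  also have "\<dots> = trace ((transpose A ** transpose Q ** B) ** Q)" by (rule trace_mul_sym)
  also have "\<dots> = A \<bullet> (transpose Q ** B ** Q)"
    by (simp add: inner_matrix_eq_trace matrix_mul_assoc)
  finally show ?thesis .
qed

lemma diag_matrix_mult_left: "(diag_matrix v ** A) $ i $ j = v $ i * A $ i $ j"
  by (simp add: matrix_matrix_mult_def diag_matrix_def if_distrib if_distribR sum.delta cong: if_cong)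

lemma diag_matrix_mult_right: "(A ** diag_matrix v) $ i $ j = A $ i $ j * v $ j"
  by (simp add: matrix_matrix_mult_def diag_matrix_def if_distrib sum.delta cong: if_cong)

lemma inner_diag_matrix: "diag_matrix a \<bullet> A = (\<Sum>i\<in>UNIV. a $ i * A $ i $ i)"
proof -
  have "transpose (diag_matrix a) = diag_matrix a"
    by (auto simp: diag_matrix_def transpose_def vec_eq_iff)
  then show ?thesis by (simp add: inner_matrix_eq_trace trace_def diag_matrix_mult_left)
qed

text \<open>Relative to the two frames only the squared entries of \<open>transpose Q ** R\<close>
  remain as weights. They form a doubly stochastic matrix, which links the matrix inner product to
  the rearrangement bound.\<close>

lemma inner_diagonalised:
  fixes Q R :: "real^'n^'n"
  shows "(Q ** diag_matrix a ** transpose Q) \<bullet> (R ** diag_matrix x ** transpose R)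
    = (\<Sum>i\<in>UNIV. \<Sum>j\<in>UNIV. a $ i * ((transpose Q ** R) $ i $ j)^2 * x $ j)"
proof -
  let ?O = "transpose Q ** R"
  have "(Q ** diag_matrix a ** transpose Q) \<bullet> (R ** diag_matrix x ** transpose R)
    = diag_matrix a \<bullet> (transpose Q ** (R ** diag_matrix x ** transpose R) ** Q)"
    by (rule inner_congruence)
  also have "transpose Q ** (R ** diag_matrix x ** transpose R) ** Q = (?O ** diag_matrix x) ** transpose ?O"
    by (simp add: matrix_transpose_mul matrix_mul_assoc)
  also have "diag_matrix a \<bullet> \<dots> = (\<Sum>i\<in>UNIV. a $ i * (\<Sum>j\<in>UNIV. (?O $ i $ j * x $ j) * ?O $ i $ j))"
    unfolding inner_diag_matrix matrix_matrix_mult_def[of "?O ** diag_matrix x"]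
    by (simp add: diag_matrix_mult_right transpose_def)
  finally show ?thesis by (simp add: sum_distrib_left power2_eq_square mult_ac)
qed

lemma orthogonal_transpose_times:
  fixes Q R :: "real^'n^'n"
  assumes "orthogonal_matrix Q" "orthogonal_matrix R"
  shows "orthogonal_matrix (transpose Q ** R)"
  by (intro orthogonal_matrix_mul) (use assms in \<open>auto simp: orthogonal_matrix_def\<close>)

lemma orthogonal_squares_doubly_stochastic:
  fixes Q :: "real^'n^'n"
  assumes "orthogonal_matrix Q"
  shows "(\<Sum>j\<in>UNIV. (Q $ i $ j)^2) = 1" "(\<Sum>i\<in>UNIV. (Q $ i $ j)^2) = 1"
proof -
  have "(Q ** transpose Q) $ i $ i = 1" "(transpose Q ** Q) $ j $ j = 1"
    using orthogonal_transpose_mult[OF assms] by (auto simp: mat_def)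
  then show "(\<Sum>j\<in>UNIV. (Q $ i $ j)^2) = 1" "(\<Sum>i\<in>UNIV. (Q $ i $ j)^2) = 1"
    by (simp_all add: matrix_matrix_mult_def transpose_def power2_eq_square)
qed

text \<open>Both diagonals consist of the roots, with multiplicity, of the characteristic polynomial
  of the same matrix.\<close>

lemma diagonalisation_unique:
  fixes Q R :: "real^'n^'n"
  assumes "orthogonal_matrix Q" "orthogonal_matrix R"
    and eq: "Q ** diag_matrix v ** transpose Q = R ** diag_matrix x ** transpose R"
  obtains \<pi> where "bij \<pi>" "x = permute_vec \<pi> v"
proof -
  have d: "det (U ** diag_matrix w ** transpose U - t *\<^sub>R mat 1) = (\<Prod>i\<in>UNIV. w $ i - t)"
    if "orthogonal_matrix U" for U :: "real^'n^'n" and w t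
  proof -
    have "U ** diag_matrix w ** transpose U - t *\<^sub>R mat 1
        = U ** diag_matrix w ** transpose U - t *\<^sub>R (U ** transpose U)"
      using orthogonal_transpose_mult[OF that] by simp
    also have "\<dots> = U ** (diag_matrix w - t *\<^sub>R mat 1) ** transpose U"
    proof -
      have Ud: "U ** (diag_matrix w - t *\<^sub>R mat 1) = U ** diag_matrix w - t *\<^sub>R U"
        unfolding diag_matrix_minus_mat
        by (simp add: vec_eq_iff diag_matrix_mult_right algebra_simps)
      show ?thesis unfolding Ud
        by (simp add: matrix_matrix_mult_def vec_eq_iff sum_subtractf sum_distrib_left algebra_simps)
    qed
    also have "det \<dots> = det (U ** transpose U) * det (diag_matrix w - t *\<^sub>R mat 1)"
      by (simp add: det_mul)
    finally show ?thesis
      using orthogonal_transpose_mult[OF that] by (simp add: diag_matrix_minus_mat det_diag_matrix)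
  qed
  have "(\<Prod>i\<in>UNIV. v $ i - t) = (\<Prod>i\<in>UNIV. x $ i - t)" for t
    using d[OF assms(1), of v t] d[OF assms(2), of x t] eq by simp
  then show ?thesis using permutation_of_prod_eq that by blast
qed

section \<open>Limits of matrices and compactness of the orthogonal group\<close>

lemma tendsto_matrix_mult:
  fixes A :: "'i \<Rightarrow> real^'n^'m" and B :: "'i \<Rightarrow> real^'k^'n"
  assumes "(A \<longlongrightarrow> a) F" "(B \<longlongrightarrow> b) F"
  shows "((\<lambda>m. A m ** B m) \<longlongrightarrow> a ** b) F"
  unfolding matrix_matrix_mult_def by (intro tendsto_intros assms)

lemma tendsto_transpose:
  fixes A :: "'i \<Rightarrow> real^'n^'m"
  assumes "(A \<longlongrightarrow> a) F"
  shows "((\<lambda>m. transpose (A m)) \<longlongrightarrow> transpose a) F"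
  unfolding transpose_def by (intro tendsto_intros assms)

lemma tendsto_diag_matrix:
  assumes "(v \<longlongrightarrow> a) F"
  shows "((\<lambda>m. diag_matrix (v m)) \<longlongrightarrow> diag_matrix a) F"
  unfolding diag_matrix_def by (intro vec_tendstoI) (auto intro!: tendsto_intros assms)

text \<open>All orthogonal matrices have squared Frobenius norm \<open>CARD('n)\<close>, and the
  equation \<open>transpose L ** L = mat 1\<close> passes to limits.\<close>

lemma orthogonal_sequence_convergent_subsequence:
  fixes R :: "nat \<Rightarrow> real^'n^'n"
  assumes "\<And>m. orthogonal_matrix (R m)"
  obtains L r where "orthogonal_matrix L" "strict_mono r" "(\<lambda>m. R (r m)) \<longlonglongrightarrow> L"
proof -
  have "R m \<bullet> R m = real CARD('n)" for m
    using orthogonal_transpose_mult[OF assms] by (simp add: inner_matrix_eq_trace trace_def mat_def)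
  then have "R m \<in> cball 0 (sqrt (real CARD('n)))" for m by (simp add: norm_eq_sqrt_inner)
  then obtain L r where L: "strict_mono r" "(R \<circ> r) \<longlonglongrightarrow> L"
    using compact_cball[of 0 "sqrt (real CARD('n))"] unfolding compact_def by metis
  then have "(\<lambda>m. transpose (R (r m)) ** R (r m)) \<longlonglongrightarrow> transpose L ** L"
    by (intro tendsto_matrix_mult tendsto_transpose) (simp_all add: o_def)
  moreover have "(\<lambda>m. transpose (R (r m)) ** R (r m)) = (\<lambda>m. mat 1)"
    using orthogonal_transpose_mult[OF assms] by simp
  ultimately have "transpose L ** L = mat 1" using LIMSEQ_unique tendsto_const by metis
  then show ?thesis using L that by (auto simp: orthogonal_matrix o_def)
qed

lemma permute_vec_inverse:
  assumes "bij \<pi>" "w = permute_vec \<pi> v"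
  shows "v = permute_vec (inv \<pi>) w"
  using assms by (simp add: permute_vec_def vec_eq_iff bij_is_surj surj_f_inv_f)

section \<open>Supergradients of a symmetric concave function and of the spectral function it
  induces\<close>

locale symmetric_concave =
  fixes \<Gamma> :: "(real^'n) set" and f :: "real^'n \<Rightarrow> real"
  assumes open_dom: "open \<Gamma>" and convex_dom: "convex \<Gamma>"
    and perm_dom: "\<And>\<pi> v. bij \<pi> \<Longrightarrow> v \<in> \<Gamma> \<Longrightarrow> permute_vec \<pi> v \<in> \<Gamma>"
    and C1: "Ck_on 1 \<Gamma> f" and concave: "concave_on \<Gamma> f"
    and perm_f: "\<And>\<pi> v. bij \<pi> \<Longrightarrow> v \<in> \<Gamma> \<Longrightarrow> f (permute_vec \<pi> v) = f v"
begin

abbreviation "grad \<equiv> differential \<Gamma> f"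

lemma f_has_derivative:
  assumes v: "v \<in> \<Gamma>"
  shows "(f has_derivative (\<lambda>k. grad v \<bullet> k)) (at v)"
proof -
  let ?D = "frechet_derivative f (at v within \<Gamma>)"
  have D: "(f has_derivative ?D) (at v within \<Gamma>)"
    using C1 v by (simp add: differentiable_on_def frechet_derivative_works)
  have "?D k = grad v \<bullet> k" for k
  proof -
    have "linear ?D" using D has_derivative_linear by blast
    then have "?D (\<Sum>i\<in>UNIV. k $ i *\<^sub>R axis i 1) = (\<Sum>i\<in>UNIV. k $ i * ?D (axis i 1))"
      by (simp add: linear_sum linear_cmul)
    moreover have "(\<Sum>i\<in>UNIV. k $ i *\<^sub>R axis i 1) = k"
      using basis_expansion[of k] by (simp add: scalar_mult_eq_scaleR)
    ultimately show ?thesis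
      by (simp add: differential_def pd_def inner_vec_def mult.commute)
  qed
  then have "?D = (\<lambda>k. grad v \<bullet> k)" by blast
  with D show ?thesis using at_within_open[OF v open_dom] by simp
qed

lemma continuous_grad: "continuous_on \<Gamma> grad"
proof -
  have "continuous_on \<Gamma> (pd \<Gamma> i f)" for i using C1 by simp
  then have "continuous_on \<Gamma> (\<lambda>v. \<chi> i. pd \<Gamma> i f v)" by (intro continuous_on_vec_lambda) simp
  then show ?thesis by (simp add: differential_def[abs_def])
qed

lemma gradient_inequality:
  assumes v: "v \<in> \<Gamma>" and x: "x \<in> \<Gamma>"
  shows "f x \<le> f v + grad v \<bullet> (x - v)"
proof -
  have "((\<lambda>t. f (v + t *\<^sub>R (x - v))) has_derivative (\<lambda>t. grad v \<bullet> (t *\<^sub>R (x - v)))) (at 0)"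
    using f_has_derivative[OF v]
    by (intro has_derivative_compose[of "\<lambda>t. v + t *\<^sub>R (x - v)" _ _ _ f])
      (auto intro!: derivative_eq_intros)
  then have "((\<lambda>t. f (v + t *\<^sub>R (x - v))) has_real_derivative grad v \<bullet> (x - v)) (at 0)"
    by (simp add: has_field_derivative_def mult.commute[of _ "grad v \<bullet> (x - v)"])
  then have "((\<lambda>t. (f (v + t *\<^sub>R (x - v)) - f v) / t) \<longlongrightarrow> grad v \<bullet> (x - v)) (at_right 0)"
    unfolding has_field_derivative_iff by (auto intro: tendsto_within_subset)
  moreover have "\<forall>\<^sub>F t in at_right 0. f x - f v \<le> (f (v + t *\<^sub>R (x - v)) - f v) / t"
  proof -
    have "f x - f v \<le> (f (v + t *\<^sub>R (x - v)) - f v) / t" if "0 < t" "t < 1" for t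
    proof -
      have "(1 - t) * f v + t * f x \<le> f ((1 - t) *\<^sub>R v + t *\<^sub>R x)"
        using concave_onD[OF concave, of t v x] that v x by simp
      also have "(1 - t) *\<^sub>R v + t *\<^sub>R x = v + t *\<^sub>R (x - v)" by (simp add: algebra_simps)
      finally show ?thesis using that by (simp add: field_simps)
    qed
    then show ?thesis unfolding eventually_at_right_field by (intro exI[of _ 1]) auto
  qed
  ultimately have "f x - f v \<le> grad v \<bullet> (x - v)"
    by (rule tendsto_lowerbound) simp
  then show ?thesis by simp
qed

text \<open>The chain rule, applied to the invariance of \<open>f\<close>, carries the permutation
  from the argument to the gradient. Evaluation at the axis vector of \<open>\<pi> j\<close> gives
  entry \<open>j\<close>.\<close>

lemma grad_permute:
  assumes \<pi>: "bij \<pi>" and v: "v \<in> \<Gamma>"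
  shows "grad (permute_vec \<pi> v) = permute_vec \<pi> (grad v)"
proof -
  have lin: "linear (permute_vec \<pi> :: real^'n \<Rightarrow> real^'n)"
    by (rule linearI) (simp_all add: permute_vec_def vec_eq_iff)
  have "((\<lambda>x. f (permute_vec \<pi> x)) has_derivative (\<lambda>k. grad (permute_vec \<pi> v) \<bullet> permute_vec \<pi> k)) (at v)"
    using f_has_derivative[OF perm_dom[OF \<pi> v]] lin
    by (intro has_derivative_compose[of "permute_vec \<pi>" _ _ _ f] linear_imp_has_derivative)
  then have "(f has_derivative (\<lambda>k. grad (permute_vec \<pi> v) \<bullet> permute_vec \<pi> k)) (at v)"
    by (rule has_derivative_transform_within_open[OF _ open_dom v]) (simp add: perm_f[OF \<pi>])
  then have eq: "(\<lambda>k. grad (permute_vec \<pi> v) \<bullet> permute_vec \<pi> k) = (\<lambda>k. grad v \<bullet> k)"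
    using f_has_derivative[OF v] has_derivative_unique by blast
  have "grad (permute_vec \<pi> v) $ j = grad v $ \<pi> j" for j
  proof -
    have "permute_vec \<pi> (axis (\<pi> j) 1) = (axis j 1 :: real^'n)"
      using \<pi> by (auto simp: permute_vec_def axis_def vec_eq_iff bij_def inj_eq)
    then show ?thesis using fun_cong[OF eq, of "axis (\<pi> j) 1"] by (simp add: inner_axis)
  qed
  then show ?thesis by (simp add: permute_vec_def vec_eq_iff)
qed

text \<open>The transposition of two equal entries fixes \<open>v\<close>, hence also its gradient.
  This removes the ambiguity of the eigenframe at repeated eigenvalues.\<close>

lemma grad_eq_component:
  assumes v: "v \<in> \<Gamma>" and "v $ i = v $ j"
  shows "grad v $ i = grad v $ j"
proof -
  let ?\<pi> = "Transposition.transpose i j"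
  have "permute_vec ?\<pi> v = v"
    using assms(2) by (auto simp: permute_vec_def vec_eq_iff Transposition.transpose_def)
  then have "permute_vec ?\<pi> (grad v) = grad v" using grad_permute[of ?\<pi> v] v by simp
  then have "permute_vec ?\<pi> (grad v) $ i = grad v $ i" by simp
  then show ?thesis by (simp add: permute_vec_def)
qed

text \<open>The matrix inner product dominates the pairing of \<open>grad v\<close> with some
  rearrangement of \<open>x\<close>, at which \<open>f\<close> has the same value as at
  \<open>x\<close>. So the gradient inequality for vectors yields a supergradient of the spectral
  function.\<close>

lemma spectral_gradient_inequality:
  assumes Q: "orthogonal_matrix Q" and R: "orthogonal_matrix R" and v: "v \<in> \<Gamma>" and x: "x \<in> \<Gamma>"
  shows "f x \<le> f v + (Q ** diag_matrix (grad v) ** transpose Q) \<bullet>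
      (R ** diag_matrix x ** transpose R - Q ** diag_matrix v ** transpose Q)"
proof -
  let ?P = "\<lambda>i j. ((transpose Q ** R) $ i $ j)^2"
  obtain \<pi> where \<pi>: "bij \<pi>"
    "(\<Sum>i\<in>UNIV. grad v $ i * x $ (\<pi> i)) \<le> (\<Sum>i\<in>UNIV. \<Sum>j\<in>UNIV. grad v $ i * ?P i j * x $ j)"
    using doubly_stochastic_permutation_bound[of UNIV UNIV ?P "\<lambda>i. grad v $ i" "\<lambda>i. x $ i"]
      orthogonal_squares_doubly_stochastic[OF orthogonal_transpose_times[OF Q R]] by auto
  have "f x = f (permute_vec \<pi> x)" by (simp add: perm_f[OF \<pi>(1) x])
  also have "\<dots> \<le> f v + grad v \<bullet> (permute_vec \<pi> x - v)"
    using gradient_inequality[OF v perm_dom[OF \<pi>(1) x]] .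
  also have "grad v \<bullet> (permute_vec \<pi> x - v) = (\<Sum>i\<in>UNIV. grad v $ i * x $ (\<pi> i)) - grad v \<bullet> v"
    by (simp add: inner_diff_right permute_vec_def) (simp add: inner_vec_def)
  also have "\<dots> \<le> (\<Sum>i\<in>UNIV. \<Sum>j\<in>UNIV. grad v $ i * ?P i j * x $ j) - grad v \<bullet> v"
    using \<pi>(2) by simp
  also have "grad v \<bullet> v = (Q ** diag_matrix (grad v) ** transpose Q) \<bullet> (Q ** diag_matrix v ** transpose Q)"
    unfolding inner_diagonalised orthogonal_transpose_mult[OF Q]
    by (simp add: mat_def inner_vec_def if_distrib if_distribR sum.delta cong: if_cong)
  finally show ?thesis
    by (simp add: inner_diff_right inner_diagonalised[of Q _ R])
qed

text \<open>The change of frame \<open>transpose Q ** R\<close> intertwines the two diagonal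
  matrices, so its nonzero entries sit where \<open>v $ i = x $ j\<close>. There the gradients agree
  too, hence it also intertwines them, and the candidate gradient depends on the matrix
  alone.\<close>

lemma spectral_gradient_unique:
  assumes Q: "orthogonal_matrix Q" and R: "orthogonal_matrix R" and v: "v \<in> \<Gamma>"
    and eq: "Q ** diag_matrix v ** transpose Q = R ** diag_matrix x ** transpose R"
  shows "x \<in> \<Gamma>"
    and "Q ** diag_matrix (grad v) ** transpose Q = R ** diag_matrix (grad x) ** transpose R"
proof -
  note QQ = orthogonal_transpose_mult[OF Q] and RR = orthogonal_transpose_mult[OF R]
  obtain \<pi> where \<pi>: "bij \<pi>" "x = permute_vec \<pi> v" using diagonalisation_unique[OF Q R eq] .
  then show x: "x \<in> \<Gamma>" using perm_dom v by simp
  let ?O = "transpose Q ** R"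
  have "diag_matrix v ** ?O = (transpose Q ** Q) ** diag_matrix v ** transpose Q ** R"
    by (simp add: QQ matrix_mul_assoc)
  also have "\<dots> = transpose Q ** (Q ** diag_matrix v ** transpose Q) ** R"
    by (simp only: matrix_mul_assoc)
  also have "\<dots> = ?O ** diag_matrix x ** (transpose R ** R)"
    unfolding eq by (simp only: matrix_mul_assoc)
  finally have O: "diag_matrix v ** ?O = ?O ** diag_matrix x" by (simp add: RR)
  have "grad v $ i * ?O $ i $ j = ?O $ i $ j * grad x $ j" for i j
  proof (cases "?O $ i $ j = 0")
    case False
    have "v $ i * ?O $ i $ j = ?O $ i $ j * x $ j"
      using arg_cong[OF O, of "\<lambda>X. X $ i $ j"] by (simp only: diag_matrix_mult_left diag_matrix_mult_right)
    then have "v $ i = v $ \<pi> j" using False by (simp add: \<pi>(2) permute_vec_def)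
    then have "grad v $ i = grad v $ \<pi> j" by (rule grad_eq_component[OF v])
    then show ?thesis using grad_permute[OF \<pi>(1) v] by (simp add: \<pi>(2) permute_vec_def)
  qed (simp only:)
  then have "diag_matrix (grad v) ** ?O = ?O ** diag_matrix (grad x)"
    by (simp only: vec_eq_iff diag_matrix_mult_left diag_matrix_mult_right) simp
  then have "Q ** (diag_matrix (grad v) ** ?O) ** transpose R = Q ** (?O ** diag_matrix (grad x)) ** transpose R"
    by simp
  then have "Q ** diag_matrix (grad v) ** transpose Q ** (R ** transpose R)
      = (Q ** transpose Q) ** R ** diag_matrix (grad x) ** transpose R"
    by (simp only: matrix_mul_assoc)
  then show "Q ** diag_matrix (grad v) ** transpose Q = R ** diag_matrix (grad x) ** transpose R"
    by (simp add: QQ RR)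
qed

text \<open>Frames of nearby matrices need not be close to \<open>Q\<close>, so the proof is by
  compactness. Along a sequence of counterexamples some subsequence of frames converges, the limit
  diagonalises the same matrix, and \<open>spectral_gradient_unique\<close> identifies the limiting
  gradient.\<close>

lemma spectral_gradient_continuous:
  assumes Q: "orthogonal_matrix Q" and v: "v \<in> \<Gamma>" and e: "e > 0"
  obtains d where "d > 0"
    "\<And>R x. orthogonal_matrix R \<Longrightarrow>
       norm (R ** diag_matrix x ** transpose R - Q ** diag_matrix v ** transpose Q) < d \<Longrightarrow>
       x \<in> \<Gamma> \<and> norm (R ** diag_matrix (grad x) ** transpose R - Q ** diag_matrix (grad v) ** transpose Q) < e"
proof (rule ccontr)
  let ?B = "Q ** diag_matrix v ** transpose Q" and ?W = "Q ** diag_matrix (grad v) ** transpose Q"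
  let ?good = "\<lambda>R x. x \<in> \<Gamma> \<and> norm (R ** diag_matrix (grad x) ** transpose R - ?W) < e"
  assume "\<not> thesis"
  then have "\<exists>R x. orthogonal_matrix R \<and> norm (R ** diag_matrix x ** transpose R - ?B) < d \<and> \<not> ?good R x"
    if "d > 0" for d
    using that \<open>\<And>d. d > 0 \<Longrightarrow> (\<And>R x. orthogonal_matrix R \<Longrightarrow>
       norm (R ** diag_matrix x ** transpose R - ?B) < d \<Longrightarrow> ?good R x) \<Longrightarrow> thesis\<close> by blast
  then have "\<forall>m. \<exists>R x. orthogonal_matrix R \<and>
      norm (R ** diag_matrix x ** transpose R - ?B) < inverse (real (Suc m)) \<and> \<not> ?good R x"
    by simp
  then obtain R x where R: "\<And>m. orthogonal_matrix (R m)"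
    and near: "\<And>m. norm (R m ** diag_matrix (x m) ** transpose (R m) - ?B) < inverse (real (Suc m))"
    and bad: "\<And>m. \<not> ?good (R m) (x m)"
    by metis
  obtain L r where L: "orthogonal_matrix L" "strict_mono r" "(\<lambda>m. R (r m)) \<longlonglongrightarrow> L"
    using orthogonal_sequence_convergent_subsequence[of R] R by blast
  note LL = orthogonal_transpose_mult[OF L(1)]
  define X where "X m = R m ** diag_matrix (x m) ** transpose (R m)" for m
  have "(\<lambda>m. X m - ?B) \<longlonglongrightarrow> 0"
    using near by (intro Lim_null_comparison[OF _ LIMSEQ_inverse_real_of_nat] always_eventually)
      (simp add: X_def less_imp_le)
  then have "X \<longlonglongrightarrow> ?B" by (simp add: LIM_zero_iff)
  then have Xr: "(\<lambda>m. X (r m)) \<longlonglongrightarrow> ?B" using L(2) LIMSEQ_subseq_LIMSEQ[of X] by (simp add: o_def)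
  \<comment> \<open>The eigenvalue vectors can only converge to the diagonal of this matrix. That
    the matrix is itself diagonal follows below, as it is a limit of diagonal matrices.\<close>
  define y where "y = (\<chi> i. (transpose L ** ?B ** L) $ i $ i)"
  have diagX: "transpose (R m) ** X m ** R m = diag_matrix (x m)" for m
  proof -
    have "transpose (R m) ** X m ** R m = (transpose (R m) ** R m) ** diag_matrix (x m) ** (transpose (R m) ** R m)"
      by (simp only: X_def matrix_mul_assoc)
    then show ?thesis by (simp add: orthogonal_transpose_mult[OF R])
  qed
  have "(\<lambda>m. transpose (R (r m)) ** X (r m) ** R (r m)) \<longlonglongrightarrow> transpose L ** ?B ** L"
    by (intro tendsto_matrix_mult tendsto_transpose L Xr)
  then have D: "(\<lambda>m. diag_matrix (x (r m))) \<longlonglongrightarrow> transpose L ** ?B ** L" by (simp only: diagX)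
  then have "(\<lambda>m. \<chi> i. diag_matrix (x (r m)) $ i $ i) \<longlonglongrightarrow> y"
    unfolding y_def by (intro tendsto_intros)
  then have xy: "(\<lambda>m. x (r m)) \<longlonglongrightarrow> y" by (simp add: diag_matrix_def)
  then have "diag_matrix y = transpose L ** ?B ** L"
    using LIMSEQ_unique[OF tendsto_diag_matrix D] by blast
  then have "L ** diag_matrix y ** transpose L = (L ** transpose L) ** ?B ** (L ** transpose L)"
    by (simp only: matrix_mul_assoc)
  then have eq: "?B = L ** diag_matrix y ** transpose L" by (simp add: LL)
  note y = spectral_gradient_unique[OF Q L(1) v eq]
  have "\<forall>\<^sub>F m in sequentially. x (r m) \<in> \<Gamma>"
    using topological_tendstoD[OF xy open_dom y(1)] .
  moreover have "(\<lambda>m. R (r m) ** diag_matrix (grad (x (r m))) ** transpose (R (r m))) \<longlonglongrightarrow> ?W"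
    unfolding y(2)
  proof (intro tendsto_matrix_mult tendsto_transpose tendsto_diag_matrix L)
    have "isCont grad y" using continuous_grad y(1) open_dom by (simp add: continuous_on_eq_continuous_at)
    then show "(\<lambda>m. grad (x (r m))) \<longlonglongrightarrow> grad y" using xy isCont_tendsto_compose by blast
  qed
  then have "\<forall>\<^sub>F m in sequentially.
      norm (R (r m) ** diag_matrix (grad (x (r m))) ** transpose (R (r m)) - ?W) < e"
    using e by (simp add: tendsto_iff dist_norm)
  ultimately have "\<forall>\<^sub>F m in sequentially. ?good (R (r m)) (x (r m))" by (rule eventually_conj)
  then show False using bad eventually_sequentially by auto
qed

lemma f_eigenvalues_diagonalised:
  assumes "orthogonal_matrix Q" "v \<in> \<Gamma>"
  shows "f (eigenvalues (mat 1) (Q ** diag_matrix v ** transpose Q)) = f v"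
  using eigenvalues_diagonalised[OF assms(1) refl, of v] perm_f assms(2) by metis

text \<open>The restriction to symmetric matrices matters: elsewhere the characteristic polynomial
  need not split over the reals, and \<open>eigenvalues\<close> is then arbitrary.\<close>

theorem spectral_function_has_derivative:
  assumes Q: "orthogonal_matrix Q" and v: "v \<in> \<Gamma>"
  shows "((\<lambda>X. f (eigenvalues (mat 1) X)) has_derivative
      (\<lambda>K. (Q ** diag_matrix (grad v) ** transpose Q) \<bullet> K))
    (at (Q ** diag_matrix v ** transpose Q) within {K. transpose K = K})"
    (is "(?F has_derivative (\<lambda>K. ?W \<bullet> K)) (at ?B within _)")
  unfolding has_derivative_within_alt
proof (intro conjI allI impI)
  show "bounded_linear (\<lambda>K. ?W \<bullet> K)" by (rule bounded_linear_inner_right)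
  fix e :: real assume "e > 0"
  then obtain d where d: "d > 0"
    "\<And>R x. orthogonal_matrix R \<Longrightarrow> norm (R ** diag_matrix x ** transpose R - ?B) < d \<Longrightarrow>
       x \<in> \<Gamma> \<and> norm (R ** diag_matrix (grad x) ** transpose R - ?W) < e"
    using spectral_gradient_continuous[OF Q v, of e] by blast
  have "norm (?F X - ?F ?B - ?W \<bullet> (X - ?B)) \<le> e * norm (X - ?B)"
    if "transpose X = X" "norm (X - ?B) < d" for X
  proof -
    obtain R x where R: "orthogonal_matrix R" and X: "X = R ** diag_matrix x ** transpose R"
      using symmetric_diagonalisation[OF \<open>transpose X = X\<close>] .
    let ?V = "R ** diag_matrix (grad x) ** transpose R"
    have x: "x \<in> \<Gamma>" "norm (?V - ?W) < e"
      using d(2)[OF R, of x] \<open>norm (X - ?B) < d\<close> by (auto simp: X)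
    have "?F X = f x" "?F ?B = f v"
      unfolding X using f_eigenvalues_diagonalised R Q x(1) v by blast+
    moreover have "f x \<le> f v + ?W \<bullet> (X - ?B)"
      unfolding X by (rule spectral_gradient_inequality[OF Q R v x(1)])
    moreover have "f v \<le> f x + ?V \<bullet> (?B - X)"
      unfolding X by (rule spectral_gradient_inequality[OF R Q x(1) v])
    moreover have "?V \<bullet> (?B - X) = - (?V \<bullet> (X - ?B))" by (simp add: inner_diff_right)
    \<comment> \<open>The first supergradient inequality bounds the error above by 0, the second
      below by \<open>(?V - ?W) \<bullet> (X - ?B)\<close>.\<close>
    ultimately have "\<bar>?F X - ?F ?B - ?W \<bullet> (X - ?B)\<bar> \<le> \<bar>(?V - ?W) \<bullet> (X - ?B)\<bar>"
      by (simp only: inner_diff_left)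
    also have "\<dots> \<le> norm (?V - ?W) * norm (X - ?B)" by (rule Cauchy_Schwarz_ineq2)
    also have "\<dots> \<le> e * norm (X - ?B)" using x(2) by (intro mult_right_mono) auto
    finally show ?thesis by simp
  qed
  then show "\<exists>d>0. \<forall>X\<in>{K. transpose K = K}. norm (X - ?B) < d \<longrightarrow>
      norm (?F X - ?F ?B - ?W \<bullet> (X - ?B)) \<le> e * norm (X - ?B)"
    using d(1) by blast
qed

end

section \<open>Symmetry of the Hessian and of the Einstein tensor\<close>

text \<open>
  Small steps in the positive coordinate directions stay in \<open>S\<close>. This is what derivatives within
  relatively open subsets of a half-space need, so that boundary points require no limiting argument.
\<close>

definition corner_open :: "(real^'n) set \<Rightarrow> bool" where
  "corner_open S \<longleftrightarrow> (\<forall>y\<in>S. \<exists>s>0. \<forall>z. norm z < s \<longrightarrow> (\<forall>i. 0 \<le> z $ i) \<longrightarrow> y + z \<in> S)"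

lemma corner_open_if_openin_halfspace:
  assumes "openin (top_of_set {y. 0 \<le> y $ k}) S"
  shows "corner_open S"
  unfolding corner_open_def
proof
  fix y assume y: "y \<in> S"
  obtain e where e: "e > 0" "ball y e \<inter> {y. 0 \<le> y $ k} \<subseteq> S"
    using assms y by (auto simp: openin_contains_ball)
  have "0 \<le> y $ k" using assms y by (auto simp: openin_contains_ball)
  then have "y + z \<in> S" if "norm z < e" "\<forall>i. 0 \<le> z $ i" for z
    using that e(2) by (auto simp: dist_norm)
  then show "\<exists>s>0. \<forall>z. norm z < s \<longrightarrow> (\<forall>i. 0 \<le> z $ i) \<longrightarrow> y + z \<in> S" using e(1) by blast
qed

text \<open>A linear map is determined by its values on the axes, so uniqueness of the derivative
  asks for arbitrarily short nonzero steps along each axis that remain in \<open>S\<close>. Positive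
  steps provide them, also at boundary points.\<close>

lemma pd_eqI:
  fixes S :: "(real^'n) set"
  assumes S: "corner_open S" "y \<in> S" and D: "(h has_derivative D) (at y within S)"
  shows "pd S i h y = D (axis i 1)"
proof -
  have "(h has_derivative frechet_derivative h (at y within S)) (at y within S)"
    using D frechet_derivative_works differentiableI by blast
  moreover have "\<exists>d. 0 < \<bar>d\<bar> \<and> \<bar>d\<bar> < e \<and> y + d *\<^sub>R b \<in> S" if b_e: "b \<in> Basis" "0 < e" for b :: "real^'n" and e :: real
  proof -
    obtain s where s: "s > 0" "\<And>z. norm z < s \<Longrightarrow> (\<forall>i. 0 \<le> z $ i) \<Longrightarrow> y + z \<in> S"
      using S by (auto simp: corner_open_def)
    obtain j where b: "b = axis j 1" using b_e(1) by (auto simp: Basis_vec_def Basis_real_def)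
    define d where "d = min s e / 2"
    have "d > 0" "d < s" "d < e" using s(1) b_e(2) by (auto simp: d_def)
    moreover have "y + d *\<^sub>R b \<in> S" using \<open>d > 0\<close> \<open>d < s\<close> by (intro s(2)) (simp add: b, simp add: b axis_def)
    ultimately show ?thesis by (intro exI[of _ d]) auto
  qed
  ultimately have "frechet_derivative h (at y within S) = D"
    using D by (intro frechet_derivative_unique_within[of h _ y S]) auto
  then show ?thesis by (simp add: pd_def)
qed

lemma has_derivative_cong_on:
  assumes "\<And>z. z \<in> S \<Longrightarrow> f z = h z" "y \<in> S"
  shows "(f has_derivative D) (at y within S) = (h has_derivative D) (at y within S)"
  using assms by (metis has_derivative_transform)

lemma pd_cong:
  assumes "\<And>z. z \<in> S \<Longrightarrow> f z = h z" "y \<in> S"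
  shows "pd S i f y = pd S i h y"
  using has_derivative_cong_on[OF assms] by (simp add: pd_def frechet_derivative_def)

context
  fixes S :: "(real^'n) set" and y :: "real^'n"
  assumes S: "corner_open S" "y \<in> S"
begin

lemma pd_const: "pd S i (\<lambda>z. c) y = 0"
  using pd_eqI[OF S has_derivative_const] by simp

lemma pd_mult:
  assumes "f differentiable (at y within S)" "h differentiable (at y within S)"
  shows "pd S i (\<lambda>z. f z * h z) y = pd S i f y * h y + f y * pd S i h y"
proof -
  from assms have "((\<lambda>z. f z * h z) has_derivative
      (\<lambda>k. f y * frechet_derivative h (at y within S) k + frechet_derivative f (at y within S) k * h y))
      (at y within S)"
    by (intro has_derivative_mult) (auto simp: frechet_derivative_works)
  from pd_eqI[OF S this] show ?thesis by (simp add: pd_def)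
qed

lemma pd_sum:
  assumes "\<And>k. k \<in> K \<Longrightarrow> f k differentiable (at y within S)"
  shows "pd S i (\<lambda>z. \<Sum>k\<in>K. f k z) y = (\<Sum>k\<in>K. pd S i (f k) y)"
proof -
  from assms have "((\<lambda>z. \<Sum>k\<in>K. f k z) has_derivative
      (\<lambda>x. \<Sum>k\<in>K. frechet_derivative (f k) (at y within S) x)) (at y within S)"
    by (intro has_derivative_sum) (auto simp: frechet_derivative_works)
  from pd_eqI[OF S this] show ?thesis by (simp add: pd_def)
qed

end

text \<open>The parameter set \<open>T\<close> may be an interval with endpoint \<open>a\<close>.
  The one-sided derivatives obtained in this way are what the mean value theorem on
  \<open>{0..s}\<close> takes.\<close>

lemma has_derivative_along_axis:
  fixes S :: "(real^'n) set"
  assumes h: "h differentiable (at (w + a *\<^sub>R axis i 1) within S)"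
    and T: "\<And>t. t \<in> T \<Longrightarrow> w + t *\<^sub>R axis i 1 \<in> S"
  shows "((\<lambda>t. h (w + t *\<^sub>R axis i 1)) has_derivative (\<lambda>t. t * pd S i h (w + a *\<^sub>R axis i 1))) (at a within T)"
proof -
  let ?D = "frechet_derivative h (at (w + a *\<^sub>R axis i 1) within S)"
  have D: "(h has_derivative ?D) (at (w + a *\<^sub>R axis i 1) within S)"
    using h by (simp add: frechet_derivative_works)
  then have "(h has_derivative ?D) (at (w + a *\<^sub>R axis i 1) within (\<lambda>t. w + t *\<^sub>R axis i 1) ` T)"
    using T by (elim has_derivative_subset) auto
  from has_derivative_in_compose[OF _ this, of "\<lambda>t. t *\<^sub>R axis i 1"]
  have "((\<lambda>t. h (w + t *\<^sub>R axis i 1)) has_derivative (\<lambda>t. ?D (t *\<^sub>R axis i 1))) (at a within T)"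
    by (rule meta_mp) (auto intro!: derivative_eq_intros)
  moreover have "linear ?D" using D has_derivative_linear by blast
  ultimately show ?thesis by (simp add: pd_def linear_cmul)
qed

text \<open>The mean value theorem is used twice: in direction \<open>i\<close> for the difference
  of \<open>h\<close> along two parallel segments, then in direction \<open>j\<close> for
  \<open>pd S i h\<close>. All points lie in a box that extends from \<open>y\<close> in positive
  directions.\<close>

lemma second_difference_mean_value:
  fixes S :: "(real^'n) set"
  assumes "s > 0"
    and box: "\<And>a b. 0 \<le> a \<Longrightarrow> a \<le> s \<Longrightarrow> 0 \<le> b \<Longrightarrow> b \<le> s \<Longrightarrow> y + a *\<^sub>R axis i 1 + b *\<^sub>R axis j 1 \<in> S"
    and h: "h differentiable_on S" "pd S i h differentiable_on S"
  obtains a b where "0 \<le> a" "a \<le> s" "0 \<le> b" "b \<le> s"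
    "h (y + s *\<^sub>R axis i 1 + s *\<^sub>R axis j 1) - h (y + s *\<^sub>R axis i 1) - h (y + s *\<^sub>R axis j 1) + h y
      = s^2 * pd S j (pd S i h) (y + a *\<^sub>R axis i 1 + b *\<^sub>R axis j 1)"
proof -
  let ?i = "axis i 1 :: real^'n" and ?j = "axis j 1 :: real^'n"
  have box1: "y + a *\<^sub>R ?i \<in> S" if "0 \<le> a" "a \<le> s" for a
    using box[of a 0] that \<open>s > 0\<close> by simp
  have box2: "y + b *\<^sub>R ?j + a *\<^sub>R ?i \<in> S" if "0 \<le> a" "a \<le> s" "0 \<le> b" "b \<le> s" for a b
    using box[of a b] that by (simp add: add_ac)
  have hd: "h differentiable (at z within S)" "pd S i h differentiable (at z within S)" if "z \<in> S" for z
    using h that by (auto simp: differentiable_on_def)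
  have "((\<lambda>a. h (y + s *\<^sub>R ?j + a *\<^sub>R ?i) - h (y + a *\<^sub>R ?i)) has_derivative
      (\<lambda>t. t * pd S i h (y + s *\<^sub>R ?j + a *\<^sub>R ?i) - t * pd S i h (y + a *\<^sub>R ?i))) (at a within {0..s})"
    if "0 \<le> a" "a \<le> s" for a
    using that \<open>s > 0\<close> by (intro has_derivative_diff has_derivative_along_axis hd box1 box2) auto
  from mvt_very_simple[of 0 s, OF _ this] \<open>s > 0\<close> obtain a where a: "0 \<le> a" "a \<le> s"
    "(h (y + s *\<^sub>R ?j + s *\<^sub>R ?i) - h (y + s *\<^sub>R ?i)) - (h (y + s *\<^sub>R ?j) - h y)
      = s * pd S i h (y + s *\<^sub>R ?j + a *\<^sub>R ?i) - s * pd S i h (y + a *\<^sub>R ?i)"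
    by auto
  have "((\<lambda>b. pd S i h (y + a *\<^sub>R ?i + b *\<^sub>R ?j)) has_derivative
      (\<lambda>t. t * pd S j (pd S i h) (y + a *\<^sub>R ?i + b *\<^sub>R ?j))) (at b within {0..s})"
    if "0 \<le> b" "b \<le> s" for b
    using that a by (intro has_derivative_along_axis hd box) auto
  from mvt_very_simple[of 0 s, OF _ this] \<open>s > 0\<close> obtain b where b: "0 \<le> b" "b \<le> s"
    "pd S i h (y + a *\<^sub>R ?i + s *\<^sub>R ?j) - pd S i h (y + a *\<^sub>R ?i)
      = s * pd S j (pd S i h) (y + a *\<^sub>R ?i + b *\<^sub>R ?j)"
    by auto
  have "h (y + s *\<^sub>R ?i + s *\<^sub>R ?j) - h (y + s *\<^sub>R ?i) - h (y + s *\<^sub>R ?j) + h y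
      = s * (pd S i h (y + a *\<^sub>R ?i + s *\<^sub>R ?j) - pd S i h (y + a *\<^sub>R ?i))"
    using a(3) by (simp add: algebra_simps)
  also have "\<dots> = s^2 * pd S j (pd S i h) (y + a *\<^sub>R ?i + b *\<^sub>R ?j)"
    using b(3) by (simp add: power2_eq_square)
  finally show ?thesis using that a b by blast
qed

text \<open>The second difference is unchanged when \<open>i\<close> and \<open>j\<close> are
  exchanged, so a value of one mixed derivative near \<open>y\<close> equals a value of the other
  near \<open>y\<close>. Continuity carries this to \<open>y\<close> itself.\<close>

lemma pd_commute:
  fixes S :: "(real^'n) set"
  assumes S: "corner_open S" "y \<in> S" and h: "Ck_on 2 S h"
  shows "pd S i (pd S j h) y = pd S j (pd S i h) y"
proof (rule ccontr)
  let ?i = "axis i 1 :: real^'n" and ?j = "axis j 1 :: real^'n"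
  let ?A = "pd S j (pd S i h)" and ?B = "pd S i (pd S j h)"
  assume ne: "?B y \<noteq> ?A y"
  have hs: "h differentiable_on S" "\<And>i. pd S i h differentiable_on S"
     "\<And>i j. continuous_on S (pd S i (pd S j h))"
    using h by (auto simp: numeral_2_eq_2)
  \<comment> \<open>Half of the supposed gap, so that two errors below \<open>e\<close> cannot
    bridge it.\<close>
  define e where "e = \<bar>?A y - ?B y\<bar> / 2"
  have e: "e > 0" using ne by (simp add: e_def)
  obtain d1 where d1: "d1 > 0" "\<And>z. z \<in> S \<Longrightarrow> dist z y < d1 \<Longrightarrow> \<bar>?A z - ?A y\<bar> < e"
    using hs(3)[of j i] S(2) e unfolding continuous_on_iff dist_real_def by metis
  obtain d2 where d2: "d2 > 0" "\<And>z. z \<in> S \<Longrightarrow> dist z y < d2 \<Longrightarrow> \<bar>?B z - ?B y\<bar> < e"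
    using hs(3)[of i j] S(2) e unfolding continuous_on_iff dist_real_def by metis
  obtain r where r: "r > 0" "\<And>z. norm z < r \<Longrightarrow> (\<forall>i. 0 \<le> z $ i) \<Longrightarrow> y + z \<in> S"
    using S by (auto simp: corner_open_def)
  \<comment> \<open>Points of the box are at distance at most \<open>2 * s\<close> from
    \<open>y\<close>; the divisor 3 makes this strictly less than all three radii.\<close>
  define s where "s = min r (min d1 d2) / 3"
  have s: "s > 0" "2 * s < r" "2 * s < d1" "2 * s < d2" using r d1 d2 by (auto simp: s_def)
  have near: "norm (a *\<^sub>R axis k 1 + b *\<^sub>R axis l 1 :: real^'n) \<le> 2 * s"
    if "0 \<le> a" "a \<le> s" "0 \<le> b" "b \<le> s" for a b k l
    using that norm_triangle_ineq[of "a *\<^sub>R axis k 1 :: real^'n" "b *\<^sub>R axis l 1"] by simp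
  have box: "y + a *\<^sub>R axis k 1 + b *\<^sub>R axis l 1 \<in> S"
    if "0 \<le> a" "a \<le> s" "0 \<le> b" "b \<le> s" for a b k l
  proof -
    have "y + (a *\<^sub>R axis k 1 + b *\<^sub>R axis l 1) \<in> S"
      using that near[OF that, of k l] s by (intro r(2)) (auto simp: axis_def)
    then show ?thesis by (simp add: add_ac)
  qed
  obtain a b where ab: "0 \<le> a" "a \<le> s" "0 \<le> b" "b \<le> s"
    "h (y + s *\<^sub>R ?i + s *\<^sub>R ?j) - h (y + s *\<^sub>R ?i) - h (y + s *\<^sub>R ?j) + h y = s^2 * ?A (y + a *\<^sub>R ?i + b *\<^sub>R ?j)"
    using second_difference_mean_value[OF s(1) box hs(1) hs(2)] by blast
  obtain a' b' where ab': "0 \<le> a'" "a' \<le> s" "0 \<le> b'" "b' \<le> s"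
    "h (y + s *\<^sub>R ?j + s *\<^sub>R ?i) - h (y + s *\<^sub>R ?j) - h (y + s *\<^sub>R ?i) + h y = s^2 * ?B (y + a' *\<^sub>R ?j + b' *\<^sub>R ?i)"
    using second_difference_mean_value[OF s(1) box hs(1) hs(2)] by blast
  have "s^2 * ?A (y + a *\<^sub>R ?i + b *\<^sub>R ?j) = s^2 * ?B (y + a' *\<^sub>R ?j + b' *\<^sub>R ?i)"
    unfolding ab(5)[symmetric] ab'(5)[symmetric] by (simp add: algebra_simps)
  then have eq: "?A (y + a *\<^sub>R ?i + b *\<^sub>R ?j) = ?B (y + a' *\<^sub>R ?j + b' *\<^sub>R ?i)"
    using s(1) by simp
  have "\<bar>?A (y + a *\<^sub>R ?i + b *\<^sub>R ?j) - ?A y\<bar> < e"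
    using near[OF ab(1-4), of i j] s by (intro d1(2) box ab) (auto simp: dist_norm add_ac)
  moreover have "\<bar>?B (y + a' *\<^sub>R ?j + b' *\<^sub>R ?i) - ?B y\<bar> < e"
    using near[OF ab'(1-4), of j i] s by (intro d2(2) box ab') (auto simp: dist_norm add_ac)
  ultimately show False using eq unfolding e_def by (auto simp: abs_if split: if_splits)
qed

section \<open>Differentiability and symmetry of the inverse metric\<close>

lemma differentiable_prod:
  fixes f :: "'i \<Rightarrow> 'a::real_normed_vector \<Rightarrow> 'b::real_normed_field"
  assumes "\<And>i. i \<in> I \<Longrightarrow> f i differentiable (at y within S)"
  shows "(\<lambda>z. \<Prod>i\<in>I. f i z) differentiable (at y within S)"
proof -
  have "\<forall>i\<in>I. \<exists>D. (f i has_derivative D) (at y within S)"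
    using assms by (simp add: differentiable_def)
  then obtain D where "\<And>i. i \<in> I \<Longrightarrow> (f i has_derivative D i) (at y within S)" by metis
  from has_derivative_prod[OF this] show ?thesis by (rule differentiableI)
qed

lemma differentiable_det:
  fixes M :: "'a::real_normed_vector \<Rightarrow> real^'n^'n"
  assumes "\<And>i j. (\<lambda>z. M z $ i $ j) differentiable (at y within S)"
  shows "(\<lambda>z. det (M z)) differentiable (at y within S)"
  unfolding det_def
  by (intro differentiable_sum ballI differentiable_mult differentiable_const differentiable_prod assms)
    (simp add: finite_permutations)

lemma matrix_inv_mult:
  fixes G :: "real^'n^'n"
  assumes "invertible G"
  shows "matrix_inv G ** G = mat 1" "G ** matrix_inv G = mat 1"
  using someI_ex[OF assms[unfolded invertible_def]] by (auto simp: matrix_inv_def)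

text \<open>Cramer's rule with an axis vector as right side. It exhibits the entries of the inverse
  as quotients of determinants, from which their differentiability within \<open>S\<close>
  follows.\<close>

lemma matrix_inv_entry:
  fixes G :: "real^'n^'n"
  assumes "invertible G"
  shows "matrix_inv G $ k $ l = det (\<chi> i j. if j = k then axis l 1 $ i else G $ i $ j) / det G"
proof -
  have "G *v (matrix_inv G *v axis l 1) = axis l 1"
    using matrix_inv_mult[OF assms] by (simp add: matrix_vector_mul_assoc)
  then have "matrix_inv G *v axis l 1 = (\<chi> k. det (\<chi> i j. if j = k then axis l 1 $ i else G $ i $ j) / det G)"
    using cramer[of G] assms by (simp add: invertible_det_nz)
  moreover have "(matrix_inv G *v axis l 1) $ k = matrix_inv G $ k $ l"
    by (simp add: matrix_vector_mul_component inner_axis)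
  ultimately show ?thesis by simp
qed

lemma differentiable_matrix_inv:
  fixes h :: "'a::real_normed_vector \<Rightarrow> real^'n^'n"
  assumes y: "y \<in> S" and inv: "\<And>z. z \<in> S \<Longrightarrow> invertible (h z)"
    and d: "\<And>i j. (\<lambda>z. h z $ i $ j) differentiable (at y within S)"
  shows "(\<lambda>z. matrix_inv (h z) $ k $ l) differentiable (at y within S)"
proof -
  let ?N = "\<lambda>z. \<chi> i j. if j = k then axis l 1 $ i else h z $ i $ j"
  have "(\<lambda>z. det (?N z) / det (h z)) differentiable (at y within S)"
  proof (intro differentiable_divide differentiable_det)
    show "(\<lambda>z. ?N z $ i $ j) differentiable (at y within S)" for i j
      using d by (cases "j = k") auto
  qed (use d inv y in \<open>auto simp: invertible_det_nz\<close>)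
  moreover have "\<exists>D. ((\<lambda>z. matrix_inv (h z) $ k $ l) has_derivative D) (at y within S)"
    if "((\<lambda>z. det (?N z) / det (h z)) has_derivative D) (at y within S)" for D
    using has_derivative_transform[OF y _ that, of "\<lambda>z. matrix_inv (h z) $ k $ l"]
       matrix_inv_entry[OF inv] by blast
  ultimately show ?thesis unfolding differentiable_def by blast
qed

lemma invertible_if_posdef:
  fixes G :: "real^'n^'n"
  assumes "\<And>v. v \<noteq> 0 \<Longrightarrow> 0 < v \<bullet> (G *v v)"
  shows "invertible G"
proof -
  have "\<forall>x. G *v x = 0 \<longrightarrow> x = 0" using assms by fastforce
  then show ?thesis by (simp add: invertible_left_inverse matrix_left_invertible_ker)
qed

lemma transpose_matrix_inv:
  fixes G :: "real^'n^'n"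
  assumes "invertible G" "transpose G = G"
  shows "transpose (matrix_inv G) = matrix_inv G"
proof -
  have "transpose (matrix_inv G) ** G = mat 1"
    using matrix_inv_mult(2)[OF assms(1)] assms(2) by (metis matrix_transpose_mul transpose_mat)
  then show ?thesis
    by (metis assms(1) matrix_inv_mult(2) matrix_mul_assoc matrix_mul_lid matrix_mul_rid)
qed

lemma symmetric_entry:
  assumes "transpose G = G"
  shows "G $ i $ j = G $ j $ i"
  using arg_cong[OF assms, of "\<lambda>X. X $ j $ i"] by (simp add: transpose_def)

section \<open>Symmetry of Christoffel symbols, Ricci tensor and Hessian\<close>

context
  fixes S :: "(real^'n) set" and h :: "real^'n \<Rightarrow> real^'n^'n"
  assumes S: "corner_open S"
    and smooth: "\<And>i j. smooth_fun_on S (\<lambda>z. h z $ i $ j)"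
    and sym: "\<And>z. z \<in> S \<Longrightarrow> transpose (h z) = h z"
    and inv: "\<And>z. z \<in> S \<Longrightarrow> invertible (h z)"
begin

lemma sym_entry: "z \<in> S \<Longrightarrow> h z $ i $ j = h z $ j $ i"
  using symmetric_entry[OF sym] .

lemma inv_sym_entry: "z \<in> S \<Longrightarrow> matrix_inv (h z) $ i $ j = matrix_inv (h z) $ j $ i"
  using symmetric_entry[OF transpose_matrix_inv[OF inv sym]] .

lemma pd_sym: "z \<in> S \<Longrightarrow> pd S l (\<lambda>z. h z $ i $ j) z = pd S l (\<lambda>z. h z $ j $ i) z"
  by (rule pd_cong) (auto simp: sym_entry)

lemma christoffel_sym: "z \<in> S \<Longrightarrow> christoffel S h k i j z = christoffel S h k j i z"
  unfolding christoffel_def using pd_sym[of z _ i j] by (simp add: add_ac)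

text \<open>On contraction two of the three derivative terms cancel, because the inverse metric is
  symmetric.\<close>

lemma christoffel_trace:
  assumes y: "y \<in> S"
  shows "(\<Sum>k\<in>UNIV. christoffel S h k i k y)
    = (1/2) * (\<Sum>k\<in>UNIV. \<Sum>l\<in>UNIV. matrix_inv (h y) $ k $ l * pd S i (\<lambda>z. h z $ k $ l) y)"
proof -
  let ?m = "matrix_inv (h y)"
  have "(\<Sum>k\<in>UNIV. \<Sum>l\<in>UNIV. ?m $ k $ l * pd S k (\<lambda>z. h z $ i $ l) y)
      = (\<Sum>k\<in>UNIV. \<Sum>l\<in>UNIV. ?m $ k $ l * pd S l (\<lambda>z. h z $ i $ k) y)"
    by (subst sum.swap) (simp add: inv_sym_entry[OF y])
  then show ?thesis
    unfolding christoffel_def sum_distrib_left[of "1/2", symmetric]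
    by (simp add: distrib_left right_diff_distrib sum.distrib sum_subtractf)
qed

lemma metric_differentiable:
  assumes "y \<in> S"
  shows "(\<lambda>z. h z $ k $ l) differentiable (at y within S)"
    "pd S i (\<lambda>z. h z $ k $ l) differentiable (at y within S)"
    "(\<lambda>z. matrix_inv (h z) $ k $ l) differentiable (at y within S)"
proof -
  have "Ck_on (Suc (Suc 0)) S (\<lambda>z. h z $ k $ l)" for k l
    using smooth by (auto simp: smooth_fun_on_def)
  then show d: "(\<lambda>z. h z $ k $ l) differentiable (at y within S)"
    "pd S i (\<lambda>z. h z $ k $ l) differentiable (at y within S)" for k l
    using assms by (auto simp: differentiable_on_def)
  show "(\<lambda>z. matrix_inv (h z) $ k $ l) differentiable (at y within S)"
    by (rule differentiable_matrix_inv) (use assms inv d in auto)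
qed

lemma christoffel_differentiable:
  assumes y: "y \<in> S"
  shows "christoffel S h k i j differentiable (at y within S)"
proof -
  have "(\<lambda>y. christoffel S h k i j y) differentiable (at y within S)"
    unfolding christoffel_def
    by (intro differentiable_mult differentiable_sum ballI differentiable_add differentiable_diff
       differentiable_const metric_differentiable[OF y] finite)
  then show ?thesis by simp
qed

text \<open>Differentiate \<open>matrix_inv (h z) ** h z = mat 1\<close> entrywise and multiply by
  the inverse from the right.\<close>

lemma pd_matrix_inv:
  assumes y: "y \<in> S"
  shows "(\<chi> k l. pd S j (\<lambda>z. matrix_inv (h z) $ k $ l) y)
     = - (matrix_inv (h y) ** (\<chi> k l. pd S j (\<lambda>z. h z $ k $ l) y) ** matrix_inv (h y))"
    (is "?dm = - (?m ** ?dh ** ?m)")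
proof -
  have "?dm ** h y + ?m ** ?dh = 0"
  proof -
    have "(\<Sum>l\<in>UNIV. pd S j (\<lambda>z. matrix_inv (h z) $ k $ l) y * h y $ l $ p + ?m $ k $ l * pd S j (\<lambda>z. h z $ l $ p) y) = 0"
      for k p
    proof -
      have "(\<Sum>l\<in>UNIV. pd S j (\<lambda>z. matrix_inv (h z) $ k $ l) y * h y $ l $ p + ?m $ k $ l * pd S j (\<lambda>z. h z $ l $ p) y)
          = pd S j (\<lambda>z. \<Sum>l\<in>UNIV. matrix_inv (h z) $ k $ l * h z $ l $ p) y"
        using metric_differentiable[OF y]
        by (subst pd_sum[OF S y]) (auto simp: pd_mult[OF S y])
      also have "\<dots> = pd S j (\<lambda>z. (mat 1 :: real^'n^'n) $ k $ p) y"
      proof (rule pd_cong[OF _ y])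
        fix z assume "z \<in> S"
        then show "(\<Sum>l\<in>UNIV. matrix_inv (h z) $ k $ l * h z $ l $ p) = (mat 1 :: real^'n^'n) $ k $ p"
          using matrix_inv_mult(1)[OF inv[OF \<open>z \<in> S\<close>]] by (simp add: matrix_matrix_mult_def vec_eq_iff)
      qed
      also have "\<dots> = 0" by (rule pd_const[OF S y])
      finally show ?thesis .
    qed
    then show ?thesis
      by (simp add: vec_eq_iff matrix_matrix_mult_def sum.distrib)
  qed
  then have "?dm ** h y = - (?m ** ?dh)" by (simp add: eq_neg_iff_add_eq_0)
  then have "?dm ** (h y ** ?m) = - (?m ** ?dh) ** ?m" by (simp add: matrix_mul_assoc)
  moreover have "- (?m ** ?dh) ** ?m = - (?m ** ?dh ** ?m)"
    by (simp add: matrix_matrix_mult_def vec_eq_iff sum_negf)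
  ultimately show ?thesis using matrix_inv_mult[OF inv[OF y]] by simp
qed

text \<open>The contracted Christoffel symbols are the components of the closed form \<open>d(ln (det h))/2\<close>.\<close>

lemma pd_christoffel_trace_sym:
  assumes y: "y \<in> S"
  shows "(\<Sum>k\<in>UNIV. pd S j (christoffel S h k i k) y) = (\<Sum>k\<in>UNIV. pd S i (christoffel S h k j k) y)"
proof -
  let ?m = "matrix_inv (h y)"
  define dh where "dh i = (\<chi> k l. pd S i (\<lambda>z. h z $ k $ l) y)" for i
  define dm where "dm j = (\<chi> k l. pd S j (\<lambda>z. matrix_inv (h z) $ k $ l) y)" for j
  have dhs: "transpose (dh i) = dh i" for i
    by (simp add: dh_def transpose_def vec_eq_iff pd_sym[OF y])
  have dm: "dm j = - (?m ** dh j ** ?m)" for j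
    unfolding dm_def dh_def by (rule pd_matrix_inv[OF y])
  \<comment> \<open>The right side is symmetric in \<open>i\<close> and \<open>j\<close>: its first
    term by cyclicity of the trace, its second because partial derivatives commute.\<close>
  have main: "(\<Sum>k\<in>UNIV. pd S j (christoffel S h k i k) y)
     = (1/2) * (- trace (?m ** dh j ** ?m ** dh i)
      + (\<Sum>k\<in>UNIV. \<Sum>l\<in>UNIV. ?m $ k $ l * pd S j (pd S i (\<lambda>z. h z $ k $ l)) y))" for i j
  proof -
    have "(\<Sum>k\<in>UNIV. pd S j (christoffel S h k i k) y) = pd S j (\<lambda>z. \<Sum>k\<in>UNIV. christoffel S h k i k z) y"
      using christoffel_differentiable[OF y] by (simp add: pd_sum[OF S y])
    also have "\<dots> = pd S j (\<lambda>y. (1/2) * (\<Sum>k\<in>UNIV. \<Sum>l\<in>UNIV. matrix_inv (h y) $ k $ l * pd S i (\<lambda>z. h z $ k $ l) y)) y"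
      by (rule pd_cong[OF christoffel_trace y])
    also have "\<dots> = (1/2) * pd S j (\<lambda>y. \<Sum>k\<in>UNIV. \<Sum>l\<in>UNIV. matrix_inv (h y) $ k $ l * pd S i (\<lambda>z. h z $ k $ l) y) y"
      by (subst pd_mult[OF S y])
        (auto intro!: differentiable_sum ballI differentiable_mult metric_differentiable[OF y] simp: pd_const[OF S y])
    also have "pd S j (\<lambda>y. \<Sum>k\<in>UNIV. \<Sum>l\<in>UNIV. matrix_inv (h y) $ k $ l * pd S i (\<lambda>z. h z $ k $ l) y) y
       = (\<Sum>k\<in>UNIV. \<Sum>l\<in>UNIV. dm j $ k $ l * dh i $ k $ l + ?m $ k $ l * pd S j (pd S i (\<lambda>z. h z $ k $ l)) y)"
      by (subst pd_sum[OF S y], intro differentiable_sum ballI differentiable_mult metric_differentiable[OF y] finite,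
          subst pd_sum[OF S y], intro differentiable_sum ballI differentiable_mult metric_differentiable[OF y] finite,
          subst pd_mult[OF S y])
        (auto intro!: metric_differentiable[OF y] simp: dm_def dh_def)
    also have "\<dots> = (\<Sum>k\<in>UNIV. \<Sum>l\<in>UNIV. dm j $ k $ l * dh i $ k $ l)
        + (\<Sum>k\<in>UNIV. \<Sum>l\<in>UNIV. ?m $ k $ l * pd S j (pd S i (\<lambda>z. h z $ k $ l)) y)"
      by (simp add: sum.distrib)
    also have "(\<Sum>k\<in>UNIV. \<Sum>l\<in>UNIV. dm j $ k $ l * dh i $ k $ l) = trace (dm j ** transpose (dh i))"
      by (simp add: trace_def matrix_matrix_mult_def transpose_def)
    also have "\<dots> = - trace (?m ** dh j ** ?m ** dh i)"
      by (simp add: dhs dm trace_def matrix_matrix_mult_def sum_negf)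
    finally show ?thesis .
  qed
  have "trace (?m ** dh j ** ?m ** dh i) = trace (?m ** dh i ** ?m ** dh j)"
    using trace_mul_sym[of "?m ** dh j" "?m ** dh i"] by (simp add: matrix_mul_assoc)
  moreover have "pd S j (pd S i (\<lambda>z. h z $ k $ l)) y = pd S i (pd S j (\<lambda>z. h z $ k $ l)) y" for k l
    using smooth by (intro pd_commute[OF S y]) (auto simp: smooth_fun_on_def)
  ultimately show ?thesis by (simp add: main)
qed

text \<open>Symmetry of the Christoffel symbols settles all terms, for the last product after
  exchanging the two sums, except the derivative of the contracted symbols; that one is symmetric as
  the contracted symbols form a closed form.\<close>

lemma transpose_ricci:
  assumes y: "y \<in> S"
  shows "transpose (ricci S h y) = ricci S h y"
proof -
  have "pd S k (christoffel S h k j i) y = pd S k (christoffel S h k i j) y" for i j k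
    by (rule pd_cong[OF _ y]) (rule christoffel_sym)
  moreover have "(\<Sum>k\<in>UNIV. \<Sum>l\<in>UNIV. christoffel S h k i l y * christoffel S h l j k y)
     = (\<Sum>k\<in>UNIV. \<Sum>l\<in>UNIV. christoffel S h k j l y * christoffel S h l i k y)" for i j
    by (subst sum.swap) (simp add: mult.commute)
  ultimately have "ricci S h y $ j $ i = ricci S h y $ i $ j" for i j
    unfolding ricci_def using pd_christoffel_trace_sym[OF y, of i j]
    by (simp add: sum_subtractf christoffel_sym[OF y, of _ j i])
  then show ?thesis by (simp add: transpose_def vec_eq_iff)
qed

lemma transpose_einstein:
  assumes y: "y \<in> S"
  shows "transpose (einstein S h y) = einstein S h y"
  using transpose_ricci[OF y] sym[OF y]
  by (simp add: einstein_def transpose_def vec_eq_iff)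

lemma transpose_hessian:
  assumes y: "y \<in> S" and w: "Ck_on 2 S w"
  shows "transpose (hessian S h w y) = hessian S h w y"
  using pd_commute[OF S y w] christoffel_sym[OF y]
  by (simp add: hessian_def transpose_def vec_eq_iff)

end

section \<open>Linearisation and ellipticity\<close>

text \<open>First \<open>G\<close> is brought to the identity by an orthogonal frame and a
  rescaling. Then \<open>B\<close> is diagonalised in the new frame by an orthogonal matrix, which
  leaves the identity unchanged.\<close>

lemma simultaneous_diagonalisation:
  fixes G B :: "real^'n^'n"
  assumes G: "transpose G = G" "\<And>v. v \<noteq> 0 \<Longrightarrow> 0 < v \<bullet> (G *v v)" and B: "transpose B = B"
  obtains E :: "real^'n^'n" and v where "invertible E" "transpose E ** G ** E = mat 1" "transpose E ** B ** E = diag_matrix v"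
proof -
  obtain Q w where Q: "orthogonal_matrix Q" and Gd: "G = Q ** diag_matrix w ** transpose Q"
    using symmetric_diagonalisation[OF G(1)] .
  note QQ = orthogonal_transpose_mult[OF Q]
  have "transpose Q ** G ** Q = (transpose Q ** Q) ** diag_matrix w ** (transpose Q ** Q)"
    unfolding Gd by (simp only: matrix_mul_assoc)
  then have Gw: "transpose Q ** G ** Q = diag_matrix w" by (simp add: QQ)
  have w: "w $ i > 0" for i
  proof -
    have e: "transpose Q *v (Q *v axis i 1) = axis i 1" by (simp add: matrix_vector_mul_assoc QQ)
    then have "Q *v axis i 1 \<noteq> 0" by (metis axis_eq_0_iff matrix_vector_mult_0_right zero_neq_one)
    then have "0 < (Q *v axis i 1) \<bullet> (G *v (Q *v axis i 1))" by (rule G(2))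
    also have "\<dots> = axis i 1 \<bullet> (transpose Q *v (G *v (Q *v axis i 1)))"
      by (metis dot_lmul_matrix transpose_transpose vector_transpose_matrix)
    also have "\<dots> = axis i 1 \<bullet> (diag_matrix w *v axis i 1)"
      by (simp add: matrix_vector_mul_assoc flip: Gw) (simp add: matrix_mul_assoc)
    also have "\<dots> = w $ i"
      by (simp add: inner_axis' matrix_vector_mul_component diag_matrix_def inner_axis)
    finally show ?thesis .
  qed
  \<comment> \<open>These factors normalise the eigenvectors of \<open>G\<close> with respect to
    \<open>G\<close>; positive definiteness makes the square roots positive.\<close>
  define s :: "real^'n" where "s = (\<chi> i. 1 / sqrt (w $ i))"
  define P where "P = Q ** diag_matrix s"
  have st: "transpose (diag_matrix s) = diag_matrix s"
    by (auto simp: diag_matrix_def transpose_def vec_eq_iff)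
  have "transpose P ** G ** P = diag_matrix s ** (transpose Q ** G ** Q) ** diag_matrix s"
    by (simp add: P_def matrix_transpose_mul st matrix_mul_assoc)
  also have "\<dots> = mat 1"
  proof -
    have "s $ i * w $ i * s $ i = 1" for i
      using w[of i] by (simp add: s_def field_simps)
    moreover have "(diag_matrix s ** diag_matrix w ** diag_matrix s) $ i $ j
        = (if i = j then s $ i * w $ i * s $ i else 0)" for i j
      unfolding diag_matrix_mult_right diag_matrix_mult_left by (simp add: diag_matrix_def)
    ultimately show ?thesis unfolding Gw by (simp add: vec_eq_iff mat_def)
  qed
  finally have PG: "transpose P ** G ** P = mat 1" .
  have "transpose (transpose P ** B ** P) = transpose P ** B ** P"
    by (simp add: matrix_transpose_mul B matrix_mul_assoc)
  then obtain R v where R: "orthogonal_matrix R" and Bd: "transpose P ** B ** P = R ** diag_matrix v ** transpose R"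
    using symmetric_diagonalisation by blast
  note RR = orthogonal_transpose_mult[OF R]
  define E where "E = P ** R"
  have "transpose E ** G ** E = transpose R ** (transpose P ** G ** P) ** R"
    by (simp add: E_def matrix_transpose_mul matrix_mul_assoc)
  then have EG: "transpose E ** G ** E = mat 1" by (simp add: PG RR)
  have "transpose E ** B ** E = transpose R ** (transpose P ** B ** P) ** R"
    by (simp add: E_def matrix_transpose_mul matrix_mul_assoc)
  also have "\<dots> = (transpose R ** R) ** diag_matrix v ** (transpose R ** R)"
    unfolding Bd by (simp only: matrix_mul_assoc)
  finally have "transpose E ** B ** E = diag_matrix v" by (simp add: RR)
  moreover have "invertible E" using EG invertible_left_inverse by blast
  ultimately show ?thesis using that EG by blast
qed

text \<open>The left inverse \<open>transpose E ** G\<close> of the square matrix \<open>E\<close>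
  is also a right inverse, so \<open>E ** transpose E\<close> is inverse to
  \<open>G\<close>.\<close>

lemma matrix_inv_congruence:
  fixes G E :: "real^'n^'n"
  assumes E: "transpose E ** G ** E = mat 1" and G: "invertible G"
  shows "matrix_inv G = E ** transpose E"
proof -
  have "E ** (transpose E ** G) = mat 1" using E matrix_left_right_inverse by blast
  then have "(E ** transpose E) ** (G ** matrix_inv G) = matrix_inv G"
    by (simp add: matrix_mul_assoc)
  then show ?thesis by (simp add: matrix_inv_mult[OF G])
qed

lemma trace_wrt_congruence:
  fixes G E :: "real^'n^'n"
  assumes "transpose E ** G ** E = mat 1" "invertible G"
  shows "trace_wrt G K = trace (transpose E ** K ** E)"
proof -
  have "trace_wrt G K = matrix_inv G \<bullet> K" by (simp add: trace_wrt_def inner_vec_def)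
  also have "\<dots> = (E ** mat 1 ** transpose E) \<bullet> K" by (simp add: matrix_inv_congruence[OF assms])
  also have "\<dots> = mat 1 \<bullet> (transpose E ** K ** E)" by (rule inner_congruence)
  finally show ?thesis by (simp add: inner_matrix_eq_trace)
qed

lemma decreasing_enumeration:
  fixes x :: "real^'n"
  obtains e where "bij_betw e {1..CARD('n)} (UNIV :: 'n set)"
    "\<And>i j. i \<in> {1..CARD('n)} \<Longrightarrow> j \<in> {i..CARD('n)} \<Longrightarrow> x $ e j \<le> x $ e i"
proof -
  obtain xs where xs: "set xs = (UNIV :: 'n set)" "distinct xs"
    using finite_distinct_list[of "UNIV :: 'n set"] by auto
  \<comment> \<open>Negated keys turn the ascending sort into a decreasing order.\<close>
  define ys where "ys = sort_key (\<lambda>i. - x $ i) xs"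
  have ys: "set ys = UNIV" "distinct ys" "sorted (map (\<lambda>i. - x $ i) ys)"
    using xs by (simp_all add: ys_def)
  then have len: "length ys = CARD('n)" using distinct_card by fastforce
  \<comment> \<open>The enumeration starts at 1, list positions at 0.\<close>
  have "bij_betw (\<lambda>i. i - 1) {1..CARD('n)} {..<CARD('n)}"
    by (rule bij_betw_byWitness[of _ Suc]) auto
  moreover have "bij_betw ((!) ys) {..<CARD('n)} UNIV"
    using ys len by (intro bij_betw_nth) auto
  ultimately have "bij_betw ((!) ys \<circ> (\<lambda>i. i - 1)) {1..CARD('n)} UNIV" by (rule bij_betw_trans)
  moreover have "x $ (ys ! (j - 1)) \<le> x $ (ys ! (i - 1))" if "i \<in> {1..CARD('n)}" "j \<in> {i..CARD('n)}" for i j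
    using sorted_nth_mono[OF ys(3), of "i - 1" "j - 1"] that len by auto
  ultimately show ?thesis using that[of "(!) ys \<circ> (\<lambda>i. i - 1)"] by simp
qed

section \<open>Coefficients and eigenvalues of the linearised operator\<close>

context symmetric_concave
begin

text \<open>In a \<open>G\<close>-orthonormal frame that diagonalises \<open>T H\<close>, the tensor
  depends on the Hessian through \<open>K \<mapsto> trace K *\<^sub>R mat 1 - K\<close> up to a
  constant. The chain rule with the derivative of the spectral function at a diagonal matrix gives
  the coefficients. Here \<open>C\<close> collects the terms without Hessian and \<open>r\<close> is
  the right side of the equation.\<close>

lemma linearisation:
  fixes G H C :: "real^'n^'n"
  defines "T K \<equiv> trace_wrt G K *\<^sub>R G - K + C"
  assumes G: "transpose G = G" "\<And>v. v \<noteq> 0 \<Longrightarrow> 0 < v \<bullet> (G *v v)"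
    and C: "transpose C = C" and H: "transpose H = H"
    and adm: "eigenvalues G (T H) \<in> \<Gamma>"
  obtains a w where "w \<in> \<Gamma>" "f w = f (eigenvalues G (T H))"
    "hessian_coefficients (\<lambda>K. f (eigenvalues G (T K)) - r) H a"
    "eigenvalues (matrix_inv G) a = (\<chi> i. (\<Sum>k\<in>UNIV. grad w $ k) - grad w $ i)"
proof -
  have T: "transpose (T K) = T K" if "transpose K = K" for K
    using G(1) C that by (simp add: T_def transpose_def vec_eq_iff)
  have Ginv: "invertible G" using G(2) by (rule invertible_if_posdef)
  obtain E :: "real^'n^'n" and v where E: "invertible E" "transpose E ** G ** E = mat 1" and Ev: "transpose E ** T H ** E = diag_matrix v"
    using simultaneous_diagonalisation[OF G T[OF H]] by blast
  have eig: "eigenvalues G (T K) = eigenvalues (mat 1) (transpose E ** T K ** E)" for K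
    using eigenvalues_congruence[OF E refl] .
  have one: "orthogonal_matrix (mat 1 :: real^'n^'n)" by (simp add: orthogonal_matrix_def)
  have mdm: "mat 1 ** diag_matrix x ** transpose (mat 1) = diag_matrix x" for x :: "real^'n" by simp
  obtain \<pi> where \<pi>: "bij \<pi>" "eigenvalues G (T H) = permute_vec \<pi> v"
    using eigenvalues_diagonalised[OF one mdm[symmetric], of v] eig[of H] Ev by metis
  have v: "v \<in> \<Gamma>"
    using permute_vec_inverse[OF \<pi>] perm_dom[OF _ adm, of "inv \<pi>"] \<pi>(1) by (simp add: bij_imp_bij_inv)
  have fv: "f (eigenvalues G (T H)) = f v" using perm_f[OF \<pi>(1) v] by (simp add: \<pi>(2))
  \<comment> \<open>The map \<open>K \<mapsto> trace K *\<^sub>R mat 1 - K\<close> is its own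
    adjoint; \<open>\<alpha> x\<close> is the diagonal of its value at
    \<open>diag_matrix (grad x)\<close>.\<close>
  define \<alpha> where "\<alpha> x = (\<chi> i. (\<Sum>k\<in>UNIV. grad x $ k) - grad x $ i)" for x
  define a where "a = E ** diag_matrix (\<alpha> v) ** transpose E"
  let ?L = "\<lambda>K. transpose E ** (trace_wrt G K *\<^sub>R G - K) ** E"
  have distr: "transpose E ** (c *\<^sub>R X + d *\<^sub>R Y) ** E
      = c *\<^sub>R (transpose E ** X ** E) + d *\<^sub>R (transpose E ** Y ** E)" for X Y :: "real^'n^'n" and c d
    by (simp add: matrix_matrix_mult_def vec_eq_iff sum.distrib sum_distrib_left sum_distrib_right algebra_simps)
  have L: "?L K = trace (transpose E ** K ** E) *\<^sub>R mat 1 - transpose E ** K ** E" for K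
    using distr[of "trace_wrt G K" G "-1" K] by (simp add: E(2) trace_wrt_congruence[OF E(2) Ginv])
  have "linear ?L"
  proof (rule linearI)
    show "?L (X + Y) = ?L X + ?L Y" for X Y
      using distr[of 1 X 1 Y] by (simp add: L trace_add algebra_simps)
    show "?L (c *\<^sub>R X) = c *\<^sub>R ?L X" for c X
      using distr[of c X 0 X] by (simp add: L trace_def sum_distrib_left algebra_simps)
  qed
  then have "(?L has_derivative ?L) (at H within {K. transpose K = K})"
    by (rule linear_imp_has_derivative)
  moreover have TL: "transpose E ** T K ** E = ?L K + transpose E ** C ** E" for K
    using distr[of 1 "trace_wrt G K *\<^sub>R G - K" 1 C] by (simp add: T_def)
  ultimately have d1: "((\<lambda>K. transpose E ** T K ** E) has_derivative ?L) (at H within {K. transpose K = K})"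
    unfolding TL by (auto intro!: derivative_eq_intros)
  have sub: "(\<lambda>K. transpose E ** T K ** E) ` {K. transpose K = K} \<subseteq> {K. transpose K = K}"
    using T by (auto simp: matrix_transpose_mul matrix_mul_assoc)
  have "((\<lambda>X. f (eigenvalues (mat 1) X)) has_derivative (\<lambda>K. diag_matrix (grad v) \<bullet> K))
      (at (transpose E ** T H ** E) within {K. transpose K = K})"
    using spectral_function_has_derivative[OF one v] unfolding mdm Ev .
  from has_derivative_in_compose[OF d1 has_derivative_subset[OF this sub]]
  have "((\<lambda>K. f (eigenvalues G (T K)) - r) has_derivative (\<lambda>K. diag_matrix (grad v) \<bullet> ?L K)) (at H within {K. transpose K = K})"
    unfolding eig[symmetric] by (auto intro!: derivative_eq_intros)
  moreover have "diag_matrix (grad v) \<bullet> ?L K = (\<Sum>i\<in>UNIV. \<Sum>j\<in>UNIV. a $ i $ j * K $ i $ j)" for K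
  proof -
    have "diag_matrix (grad v) \<bullet> ?L K = diag_matrix (\<alpha> v) \<bullet> (transpose E ** K ** E)"
      unfolding L inner_diag_matrix
      by (simp add: \<alpha>_def trace_def mat_def algebra_simps sum_subtractf sum.distrib)
        (simp add: sum_distrib_left sum_distrib_right, rule sum.swap)
    also have "\<dots> = a \<bullet> K" unfolding a_def by (rule inner_congruence[symmetric])
    finally show ?thesis by (simp add: inner_vec_def)
  qed
  ultimately have "((\<lambda>K. f (eigenvalues G (T K)) - r) has_derivative
      (\<lambda>K. \<Sum>i\<in>UNIV. \<Sum>j\<in>UNIV. a $ i $ j * K $ i $ j)) (at H within {K. transpose K = K})"
    by (simp only:)
  moreover have diag_sym: "transpose (diag_matrix x) = diag_matrix x" for x :: "real^'n"
    by (auto simp: diag_matrix_def transpose_def vec_eq_iff)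
  have "transpose a = a" by (simp add: a_def matrix_transpose_mul matrix_mul_assoc diag_sym)
  ultimately have hc: "hessian_coefficients (\<lambda>K. f (eigenvalues G (T K)) - r) H a"
    by (simp add: hessian_coefficients_def)
  \<comment> \<open>As \<open>a\<close> has upper indices, it is diagonalised by the dual frame, in
    which the inverse metric becomes the identity.\<close>
  let ?F = "G ** E"
  have Ft: "transpose ?F = transpose E ** G" by (simp add: matrix_transpose_mul G(1))
  have "eigenvalues (matrix_inv G) a = eigenvalues (mat 1) (diag_matrix (\<alpha> v))"
  proof (rule eigenvalues_congruence)
    show "invertible ?F" using Ginv E(1) by (rule invertible_mult)
    have "transpose ?F ** matrix_inv G ** ?F = (transpose E ** G ** E) ** (transpose E ** G ** E)"
      unfolding Ft matrix_inv_congruence[OF E(2) Ginv] by (simp only: matrix_mul_assoc)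
    then show "transpose ?F ** matrix_inv G ** ?F = mat 1" by (simp add: E(2))
    have "transpose ?F ** a ** ?F = (transpose E ** G ** E) ** diag_matrix (\<alpha> v) ** (transpose E ** G ** E)"
      unfolding Ft a_def by (simp only: matrix_mul_assoc)
    then show "transpose ?F ** a ** ?F = diag_matrix (\<alpha> v)" by (simp add: E(2))
  qed
  then obtain \<rho> where \<rho>: "bij \<rho>" "eigenvalues (matrix_inv G) a = permute_vec \<rho> (\<alpha> v)"
    using eigenvalues_diagonalised[OF one mdm[symmetric], of "\<alpha> v"] by metis
  \<comment> \<open>The choice in \<open>eigenvalues\<close> may use another order than
    \<open>\<alpha> v\<close>. Permutations preserve the sum of the gradient, so the order is
    absorbed by taking \<open>permute_vec \<rho> v\<close> for \<open>w\<close>.\<close>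
  have "(\<Sum>k\<in>UNIV. grad v $ \<rho> k) = (\<Sum>k\<in>UNIV. grad v $ k)"
    using sum.reindex_bij_betw[OF \<rho>(1)] .
  then have "permute_vec \<rho> (\<alpha> v) = \<alpha> (permute_vec \<rho> v)"
    unfolding \<alpha>_def grad_permute[OF \<rho>(1) v] by (simp add: permute_vec_def)
  then show ?thesis
    using that[OF perm_dom[OF \<rho>(1) v] _ hc] fv perm_f[OF \<rho>(1) v] \<rho>(2) by (simp add: \<alpha>_def)
qed

lemma grad_inner_pos:
  assumes scale: "\<And>v t. v \<in> \<Gamma> \<Longrightarrow> t > 0 \<Longrightarrow> t *\<^sub>R v \<in> \<Gamma>"
    and v: "v \<in> \<Gamma>" and \<mu>: "\<mu> \<in> \<Gamma>"
    and lim: "\<And>\<mu>. \<mu> \<in> \<Gamma> \<Longrightarrow> \<exists>L::ereal. ((\<lambda>t. ereal (f (t *\<^sub>R \<mu>))) \<longlongrightarrow> L) at_top \<and> ereal (f v) < L"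
  shows "grad v \<bullet> \<mu> > 0"
proof -
  have ray: "\<exists>t>1. grad v \<bullet> v < t * (grad v \<bullet> \<mu>)" if \<mu>: "\<mu> \<in> \<Gamma>" for \<mu>
  proof -
    obtain L :: ereal where "((\<lambda>t. ereal (f (t *\<^sub>R \<mu>))) \<longlongrightarrow> L) at_top" "ereal (f v) < L"
      using lim[OF \<mu>] by blast
    then have "\<forall>\<^sub>F t in at_top. ereal (f v) < ereal (f (t *\<^sub>R \<mu>))" by (rule order_tendstoD)
    then have "\<forall>\<^sub>F t::real in at_top. t > 1 \<and> f v < f (t *\<^sub>R \<mu>)"
      using eventually_gt_at_top[of 1] by eventually_elim simp
    then obtain t :: real where t: "t > 1" "f v < f (t *\<^sub>R \<mu>)"
      by (auto simp: eventually_at_top_linorder)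
    have "f (t *\<^sub>R \<mu>) \<le> f v + grad v \<bullet> (t *\<^sub>R \<mu> - v)"
      using t by (intro gradient_inequality v scale \<mu>) simp
    then show ?thesis using t by (intro exI[of _ t]) (simp add: inner_diff_right)
  qed
  \<comment> \<open>The ray argument is used twice. Along \<open>v\<close> itself it gives
    \<open>grad v \<bullet> v > 0\<close> because \<open>t > 1\<close>; along \<open>\<mu>\<close>
    this is the positive lower bound for \<open>t * (grad v \<bullet> \<mu>)\<close>.\<close>
  obtain t where "t > 1" "grad v \<bullet> v < t * (grad v \<bullet> v)" using ray[OF v] by blast
  then have "0 < (t - 1) * (grad v \<bullet> v)" by (simp add: algebra_simps)
  then have pos: "0 < grad v \<bullet> v" using \<open>t > 1\<close> by (simp add: zero_less_mult_iff)
  obtain t where "t > 1" "grad v \<bullet> v < t * (grad v \<bullet> \<mu>)" using ray[OF \<mu>] by blast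
  then have "0 < t * (grad v \<bullet> \<mu>)" using pos by linarith
  then show ?thesis using \<open>t > 1\<close> by (simp add: zero_less_mult_iff)
qed

end

section \<open>Bounds on gradients that are positive on the cone\<close>

lemma nonneg_if_inner_pos_Gamma_n:
  fixes q :: "real^'n"
  assumes "\<And>\<mu>. \<mu> \<in> Gamma_n \<Longrightarrow> q \<bullet> \<mu> > 0"
  shows "0 < (\<Sum>i\<in>UNIV. q $ i)" "0 \<le> q $ i"
proof -
  have one: "(\<chi> i. 1) \<in> Gamma_n" by (simp add: Gamma_n_def)
  from assms[OF this] show S: "0 < (\<Sum>i\<in>UNIV. q $ i)" by (simp add: inner_vec_def)
  show "0 \<le> q $ i"
  proof (rule ccontr)
    assume neg: "\<not> 0 \<le> q $ i"
    \<comment> \<open>Raising entry \<open>i\<close> of the all-ones vector by this amount makes its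
      inner product with \<open>q\<close> exactly 0.\<close>
    define s where "s = (\<Sum>i\<in>UNIV. q $ i) / (- q $ i)"
    have "s > 0" unfolding s_def using S neg by (intro divide_pos_pos) auto
    then have "(\<chi> j. 1) + axis i s \<in> Gamma_n" by (auto simp: Gamma_n_def axis_def)
    from assms[OF this] have "0 < (\<Sum>i\<in>UNIV. q $ i) + q $ i * s"
      by (simp add: inner_add_right inner_axis) (simp add: inner_vec_def)
    then show False using neg by (simp add: s_def)
  qed
qed

text \<open>A vector of the cone with a negative entry, moved to position \<open>i\<close>, bounds
  \<open>q $ i\<close> by the other entries of \<open>q\<close>. As \<open>\<kappa>\<close> is fixed
  by that vector before \<open>q\<close> is given, the resulting ellipticity constant is
  uniform.\<close>

lemma cone_gradient_gap:
  fixes \<Gamma> :: "(real^'n) set"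
  assumes cone: "admissible_cone \<Gamma>" and ne: "\<Gamma> \<noteq> Gamma_n"
  obtains \<kappa> where "\<kappa> > 0"
    "\<And>q i. (\<And>\<mu>. \<mu> \<in> \<Gamma> \<Longrightarrow> q \<bullet> \<mu> > 0) \<Longrightarrow> \<kappa> * q $ i \<le> (\<Sum>k\<in>UNIV. q $ k) - q $ i"
proof -
  have sub: "Gamma_n \<subseteq> \<Gamma>" and op: "open \<Gamma>" and perm: "\<And>\<pi> v. bij \<pi> \<Longrightarrow> v \<in> \<Gamma> \<Longrightarrow> permute_vec \<pi> v \<in> \<Gamma>"
    using cone by (auto simp: admissible_cone_def)
  obtain \<mu>0 where "\<mu>0 \<in> \<Gamma>" "\<mu>0 \<notin> Gamma_n" using sub ne by blast
  then obtain i0 where i0: "\<mu>0 $ i0 \<le> 0" by (auto simp: Gamma_n_def not_less)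
  obtain e where e: "e > 0" "ball \<mu>0 e \<subseteq> \<Gamma>" using op \<open>\<mu>0 \<in> \<Gamma>\<close> open_contains_ball by blast
  \<comment> \<open>The entry of \<open>\<mu>0\<close> may be 0; openness leaves room to make it
    strictly negative.\<close>
  define \<mu> where "\<mu> = \<mu>0 - (e / 2) *\<^sub>R axis i0 1"
  have \<mu>: "\<mu> \<in> \<Gamma>" using e by (intro subsetD[OF e(2)]) (simp add: \<mu>_def dist_norm)
  have neg: "\<mu> $ i0 < 0" using i0 e(1) by (simp add: \<mu>_def)
  then have N: "norm \<mu> > 0" by auto
  define \<kappa> where "\<kappa> = - \<mu> $ i0 / norm \<mu>"
  have "\<kappa> * q $ i \<le> (\<Sum>k\<in>UNIV. q $ k) - q $ i" if q: "\<And>\<mu>. \<mu> \<in> \<Gamma> \<Longrightarrow> q \<bullet> \<mu> > 0" for q i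
  proof -
    \<comment> \<open>This moves the negative entry from position \<open>i0\<close> to position
      \<open>i\<close>; the other entries are then bounded by \<open>norm \<mu>\<close>.\<close>
    let ?\<pi> = "Transposition.transpose i i0"
    have nonneg: "0 \<le> q $ k" for k using nonneg_if_inner_pos_Gamma_n(2)[of q] q sub by blast
    have "0 < q \<bullet> permute_vec ?\<pi> \<mu>" using q perm[OF _ \<mu>, of ?\<pi>] by simp
    also have "\<dots> = (\<Sum>k\<in>UNIV. q $ k * permute_vec ?\<pi> \<mu> $ k)" by (simp add: inner_vec_def)
    also have "\<dots> = q $ i * \<mu> $ i0 + (\<Sum>k\<in>UNIV - {i}. q $ k * permute_vec ?\<pi> \<mu> $ k)"
      by (subst sum.remove[of UNIV i]) (auto simp: permute_vec_def)
    also have "\<dots> \<le> q $ i * \<mu> $ i0 + (\<Sum>k\<in>UNIV - {i}. q $ k * norm \<mu>)"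
    proof -
      have "permute_vec ?\<pi> \<mu> $ k \<le> norm \<mu>" for k
        using component_le_norm_cart[of \<mu> "?\<pi> k"] by (simp add: permute_vec_def)
      then show ?thesis using nonneg by (intro add_left_mono sum_mono mult_left_mono) auto
    qed
    also have "(\<Sum>k\<in>UNIV - {i}. q $ k * norm \<mu>) = ((\<Sum>k\<in>UNIV. q $ k) - q $ i) * norm \<mu>"
      using sum.remove[of UNIV i "\<lambda>k. q $ k"] by (simp add: sum_distrib_right[symmetric])
    finally have "- \<mu> $ i0 * q $ i \<le> ((\<Sum>k\<in>UNIV. q $ k) - q $ i) * norm \<mu>"
      by (simp add: mult.commute)
    then show ?thesis using N by (simp add: \<kappa>_def field_simps)
  qed
  moreover have "\<kappa> > 0" unfolding \<kappa>_def using neg N by (intro divide_pos_pos) auto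
  ultimately show ?thesis using that by blast
qed

section \<open>Application to solutions of the equation\<close>

lemma symmetric_concave_admissible:
  assumes "admissible_cone \<Gamma>" "admissible_function \<Gamma> f"
  shows "symmetric_concave \<Gamma> f"
  using assms by unfold_locales
    (auto simp: admissible_cone_def admissible_function_def smooth_fun_on_def)

lemma solution_linearisation:
  fixes g :: "('a::t2_space, 'n::finite) metric"
  assumes manifold: "compact_smooth_manifold M A" and metric: "riemannian_metric A g"
    and cone: "admissible_cone \<Gamma>" and f: "admissible_function \<Gamma> f"
    and sol: "is_solution A g \<Gamma> f \<psi> u" and below: "rhs_below_sup A \<Gamma> f \<psi> u"
    and c: "c \<in> A" and y: "y \<in> chart_image c"
  obtains a q where
    "hessian_coefficients (equation_operator g f \<psi> c y (value_at c u y) (differential_at c u y))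
       (hessian_at g c u y) a"
    "eigenvalues (matrix_inv (g c y)) a = (\<chi> i. (\<Sum>k\<in>UNIV. q $ k) - q $ i)"
    "\<And>\<mu>. \<mu> \<in> \<Gamma> \<Longrightarrow> q \<bullet> \<mu> > 0"
proof -
  interpret symmetric_concave \<Gamma> f by (rule symmetric_concave_admissible[OF cone f])
  let ?S = "chart_image c" and ?G = "g c y" and ?H = "hessian_at g c u y" and ?p = "differential_at c u y"
  obtain k where "openin (top_of_set {y. 0 \<le> y $ k}) ?S"
    using manifold c by (auto simp: compact_smooth_manifold_def is_chart_def)
  then have S: "corner_open ?S" by (rule corner_open_if_openin_halfspace)
  have smooth: "smooth_fun_on ?S (\<lambda>y. g c y $ i $ j)" for i j
    using metric c by (auto simp: riemannian_metric_def)
  have sym: "transpose (g c z) = g c z" and pos: "v \<noteq> 0 \<Longrightarrow> 0 < v \<bullet> (g c z *v v)" if "z \<in> ?S" for z v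
    using metric c that by (auto simp: riemannian_metric_def)
  have inv: "invertible (g c z)" if "z \<in> ?S" for z
    using pos[OF that] by (rule invertible_if_posdef)
  define C where "C = (1 / (real CARD('n) - 2)) *\<^sub>R einstein ?S (g c) y
     + ((real CARD('n) - 3) / 2 * norm_sq_wrt ?G ?p) *\<^sub>R ?G + (\<chi> i j. ?p $ i * ?p $ j)"
  have T: "equation_tensor g c y ?p K = trace_wrt ?G K *\<^sub>R ?G - K + C" for K
    by (simp add: equation_tensor_def C_def add.assoc)
  have "transpose (einstein ?S (g c) y) = einstein ?S (g c) y"
    by (rule transpose_einstein[OF S smooth sym inv y])
  then have Csym: "transpose C = C"
    using sym[OF y] by (simp add: C_def transpose_def vec_eq_iff mult.commute)
  have "Ck_on 2 ?S (u \<circ> chart_point c)" using sol c by (simp add: is_solution_def Ck_fun_def)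
  note Hsym = transpose_hessian[OF S smooth sym inv y this]
  have adm: "eigenvalues ?G (trace_wrt ?G ?H *\<^sub>R ?G - ?H + C) \<in> \<Gamma>"
    and eq: "f (eigenvalues ?G (trace_wrt ?G ?H *\<^sub>R ?G - ?H + C)) = equation_rhs \<psi> c y (value_at c u y)"
    using sol c y unfolding T[symmetric] by (simp_all add: is_solution_def equation_operator_def)
  obtain a w where w: "w \<in> \<Gamma>" "f w = f (eigenvalues ?G (trace_wrt ?G ?H *\<^sub>R ?G - ?H + C))"
    and a: "hessian_coefficients (\<lambda>K. f (eigenvalues ?G (trace_wrt ?G K *\<^sub>R ?G - K + C))
        - equation_rhs \<psi> c y (value_at c u y)) ?H a"
      "eigenvalues (matrix_inv ?G) a = (\<chi> i. (\<Sum>k\<in>UNIV. grad w $ k) - grad w $ i)"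
    using linearisation[OF sym[OF y] pos[OF y] Csym Hsym adm] by blast
  \<comment> \<open>By the equation \<open>f w\<close> equals the right side. The strict inequality
    lets \<open>f w\<close> serve as the level \<open>\<sigma>\<close> in the growth condition along
    rays.\<close>
  have "ereal (f w) < sup_on \<Gamma> f"
    using below c y w(2) eq by (simp add: rhs_below_sup_def)
  then have lim: "\<exists>L::ereal. ((\<lambda>t. ereal (f (t *\<^sub>R \<mu>))) \<longlongrightarrow> L) at_top \<and> ereal (f w) < L" if "\<mu> \<in> \<Gamma>" for \<mu>
    using f that by (simp add: admissible_function_def)
  have scale: "t *\<^sub>R v \<in> \<Gamma>" if "v \<in> \<Gamma>" "t > 0" for v t
    using cone that by (simp add: admissible_cone_def)
  have op: "equation_operator g f \<psi> c y (value_at c u y) ?p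
      = (\<lambda>K. f (eigenvalues ?G (trace_wrt ?G K *\<^sub>R ?G - K + C)) - equation_rhs \<psi> c y (value_at c u y))"
    by (simp add: equation_operator_def T fun_eq_iff)
  show ?thesis
    by (rule that[OF _ a(2)]) (simp_all only: op a(1) grad_inner_pos[OF scale w(1) _ lim])
qed

text \<open>With \<open>s\<close> the sum of the entries of \<open>q\<close>, the eigenvalues are
  \<open>s - q $ i\<close>. Decreasing order of these is increasing order of the
  \<open>q $ i\<close>, and their sum is \<open>(CARD('n) - 1) * s\<close>. Hence a bound by
  \<open>\<theta> * s\<close> gives the ellipticity constant
  \<open>\<theta> / (CARD('n) - 1)\<close>.\<close>

lemma k_uniformly_elliptic_if_linearisation:
  fixes g :: "('a, 'n::finite) metric"
  assumes dim: "CARD('n) \<ge> 2" and \<theta>: "\<theta> > 0"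
    and lin: "\<And>u c y. u \<in> Y \<Longrightarrow> c \<in> A \<Longrightarrow> y \<in> chart_image c \<Longrightarrow> \<exists>a q.
       hessian_coefficients (\<Phi> c y (value_at c u y) (differential_at c u y)) (hessian_at g c u y) a \<and>
       eigenvalues (matrix_inv (g c y)) a = (\<chi> i. (\<Sum>k\<in>UNIV. q $ k) - q $ i) \<and> Q q"
    and Q: "\<And>q i. Q q \<Longrightarrow> 0 \<le> q $ i" "\<And>q. Q q \<Longrightarrow> 0 < (\<Sum>k\<in>UNIV. q $ k)"
    and bound: "\<And>q e i. Q q \<Longrightarrow> bij_betw e {1..CARD('n)} (UNIV :: 'n set) \<Longrightarrow>
       (\<And>i j. i \<in> {1..CARD('n)} \<Longrightarrow> j \<in> {i..CARD('n)} \<Longrightarrow> q $ e i \<le> q $ e j) \<Longrightarrow> i \<in> {1..k} \<Longrightarrow>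
       \<theta> * (\<Sum>k\<in>UNIV. q $ k) \<le> (\<Sum>k\<in>UNIV. q $ k) - q $ e i"
  shows "k_uniformly_elliptic k A g \<Phi> Y"
  unfolding k_uniformly_elliptic_def
proof (intro exI[of _ "\<theta> / (real CARD('n) - 1)"] conjI ballI)
  show "0 < \<theta> / (real CARD('n) - 1)" using dim \<theta> by simp
  fix u c y assume "u \<in> Y" "c \<in> A" "y \<in> chart_image c"
  then obtain a q where
    a: "hessian_coefficients (\<Phi> c y (value_at c u y) (differential_at c u y)) (hessian_at g c u y) a"
      "eigenvalues (matrix_inv (g c y)) a = (\<chi> i. (\<Sum>k\<in>UNIV. q $ k) - q $ i)" and q: "Q q"
    using lin by blast
  define s where "s = (\<Sum>k\<in>UNIV. q $ k)"
  define \<alpha> where "\<alpha> = (\<chi> i. s - q $ i)"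
  have \<alpha>: "\<alpha> $ i = s - q $ i" for i by (simp add: \<alpha>_def)
  obtain e where e: "bij_betw e {1..CARD('n)} (UNIV :: 'n set)"
    "\<And>i j. i \<in> {1..CARD('n)} \<Longrightarrow> j \<in> {i..CARD('n)} \<Longrightarrow> \<alpha> $ e j \<le> \<alpha> $ e i"
    using decreasing_enumeration[of \<alpha>] by blast
  have "(\<Sum>j=1..CARD('n). \<alpha> $ e j) = (\<Sum>i\<in>UNIV. \<alpha> $ i)"
    using sum.reindex_bij_betw[OF e(1)] .
  also have "\<dots> = (real CARD('n) - 1) * s"
    by (simp add: \<alpha> sum_subtractf algebra_simps flip: s_def)
  finally have sum: "(\<Sum>j=1..CARD('n). \<alpha> $ e j) = (real CARD('n) - 1) * s" .
  have s: "s > 0" using Q(2)[OF q] by (simp add: s_def)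
  have "q $ i \<le> s" for i
    unfolding s_def using Q(1)[OF q] by (intro member_le_sum) auto
  then have nonneg: "\<forall>i\<in>{1..CARD('n)}. 0 \<le> \<alpha> $ e i" by (simp add: \<alpha>)
  have bnd: "\<theta> / (real CARD('n) - 1) * (\<Sum>j=1..CARD('n). \<alpha> $ e j) \<le> \<alpha> $ e i" if "i \<in> {1..k}" for i
  proof -
    have "\<theta> / (real CARD('n) - 1) * ((real CARD('n) - 1) * s) = \<theta> * s" using dim by simp
    moreover have "\<theta> * s \<le> s - q $ e i"
      unfolding s_def using e(2) by (intro bound[OF q e(1) _ that]) (simp add: \<alpha>)
    ultimately show ?thesis unfolding sum unfolding \<alpha> by (simp only:)
  qed
  have "0 < (\<Sum>j=1..CARD('n). \<alpha> $ e j)" unfolding sum using s dim by simp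
  then show "\<exists>a. hessian_coefficients (\<Phi> c y (value_at c u y) (differential_at c u y)) (hessian_at g c u y) a \<and>
        (let \<alpha> = eigenvalues (matrix_inv (g c y)) a in
         \<exists>e. bij_betw e {1..CARD('n)} (UNIV :: 'n set) \<and>
             (\<forall>i\<in>{1..CARD('n)}. \<forall>j\<in>{i..CARD('n)}. \<alpha> $ e j \<le> \<alpha> $ e i) \<and>
             (\<forall>i\<in>{1..CARD('n)}. 0 \<le> \<alpha> $ e i) \<and>
             0 < (\<Sum>j=1..CARD('n). \<alpha> $ e j) \<and>
             (\<forall>i\<in>{1..k}. \<theta> / (real CARD('n) - 1) * (\<Sum>j=1..CARD('n). \<alpha> $ e j) \<le> \<alpha> $ e i))"
    unfolding Let_def using a(1) e nonneg bnd
    by (intro exI[of _ a] conjI exI[of _ e]) (simp_all add: a(2) flip: s_def \<alpha>_def)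
qed

theorem proposition3p1:
  fixes M :: "'a::t2_space set"
    and A :: "('a, 'n::finite) chart set"
    and g :: "('a, 'n) metric"
    and \<Gamma> :: "(real^'n) set"
    and f :: "real^'n \<Rightarrow> real"
    and \<psi> :: "'a \<Rightarrow> real"
  assumes dim: "CARD('n) \<ge> 3"
    and manifold: "compact_smooth_manifold M A"
    and metric: "riemannian_metric A g"
    and cone: "admissible_cone \<Gamma>"
    and f: "admissible_function \<Gamma> f"
    and psi_smooth: "smooth_fun A \<psi>"
    and psi_pos: "\<forall>x\<in>M. \<psi> x > 0"
  defines "sols \<equiv> {u. is_solution A g \<Gamma> f \<psi> u \<and> einstein_admissible A g \<Gamma> u \<and>
                        rhs_below_sup A \<Gamma> f \<psi> u}"
  shows "(\<Gamma> \<noteq> Gamma_n \<longrightarrow>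
            fully_uniformly_elliptic A g (equation_operator g f \<psi>) sols) \<and>
         (\<Gamma> = Gamma_n \<longrightarrow>
            k_uniformly_elliptic (CARD('n) - 1) A g (equation_operator g f \<psi>) sols)"
proof (intro conjI impI)
  let ?Q = "\<lambda>q. \<forall>\<mu>\<in>\<Gamma>. q \<bullet> \<mu> > 0"
  have dim2: "CARD('n) \<ge> 2" using dim by simp
  have lin: "\<exists>a q. hessian_coefficients (equation_operator g f \<psi> c y (value_at c u y) (differential_at c u y))
         (hessian_at g c u y) a \<and>
       eigenvalues (matrix_inv (g c y)) a = (\<chi> i. (\<Sum>k\<in>UNIV. q $ k) - q $ i) \<and> ?Q q"
    if u: "u \<in> sols" and c: "c \<in> A" and y: "y \<in> chart_image c" for u c y
  proof -
    have "is_solution A g \<Gamma> f \<psi> u" "rhs_below_sup A \<Gamma> f \<psi> u" using u by (simp_all add: sols_def)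
    from solution_linearisation[OF manifold metric cone f this c y] show ?thesis by metis
  qed
  have "Gamma_n \<subseteq> \<Gamma>" using cone by (simp add: admissible_cone_def)
  then have Q: "0 < (\<Sum>k\<in>UNIV. q $ k)" "0 \<le> q $ i" if "?Q q" for q i
    using nonneg_if_inner_pos_Gamma_n[of q] that by blast+
  show "fully_uniformly_elliptic A g (equation_operator g f \<psi>) sols" if ne: "\<Gamma> \<noteq> Gamma_n"
  proof -
    obtain \<kappa> where \<kappa>: "\<kappa> > 0"
      "\<And>q i. (\<And>\<mu>. \<mu> \<in> \<Gamma> \<Longrightarrow> q \<bullet> \<mu> > 0) \<Longrightarrow> \<kappa> * q $ i \<le> (\<Sum>k\<in>UNIV. q $ k) - q $ i"
      using cone_gradient_gap[OF cone ne] by blast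
    show ?thesis unfolding fully_uniformly_elliptic_def
    proof (rule k_uniformly_elliptic_if_linearisation[OF dim2 _ lin Q(2) Q(1)])
      \<comment> \<open>With \<open>s\<close> the sum of \<open>q\<close>, the gap
        \<open>\<kappa> * q $ i \<le> s - q $ i\<close> gives
        \<open>q $ i \<le> s / (1 + \<kappa>)\<close>, so that \<open>s - q $ i\<close> is at least
        \<open>\<kappa> / (1 + \<kappa>) * s\<close>.\<close>
      show "0 < \<kappa> / (1 + \<kappa>)" using \<kappa>(1) by simp
      show "\<kappa> / (1 + \<kappa>) * (\<Sum>k\<in>UNIV. q $ k) \<le> (\<Sum>k\<in>UNIV. q $ k) - q $ e i" if "?Q q" for q e and i :: nat
        using \<kappa>(2)[of q "e i"] \<kappa>(1) that by (simp add: field_simps)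
    qed
  qed
  show "k_uniformly_elliptic (CARD('n) - 1) A g (equation_operator g f \<psi>) sols"
  proof (rule k_uniformly_elliptic_if_linearisation[OF dim2 _ lin Q(2) Q(1)])
    \<comment> \<open>The enumeration \<open>e\<close> lists the largest entry of \<open>q\<close>
      last, and the indices up to \<open>CARD('n) - 1\<close> omit it. Any earlier entry is at most
      the last one, and together they are at most the sum, so it is at most half of the sum.\<close>
    show "0 < (1/2 :: real)" by simp
    fix q and e :: "nat \<Rightarrow> 'n" and i
    assume q: "?Q q" and e: "bij_betw e {1..CARD('n)} UNIV" and i: "i \<in> {1..CARD('n) - 1}"
      and mono: "\<And>i j. i \<in> {1..CARD('n)} \<Longrightarrow> j \<in> {i..CARD('n)} \<Longrightarrow> q $ e i \<le> q $ e j"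
    have "i \<noteq> CARD('n)" "i \<in> {1..CARD('n)}" "CARD('n) \<in> {1..CARD('n)}" using i dim by auto
    then have "e i \<noteq> e CARD('n)"
      using inj_onD[OF bij_betw_imp_inj_on[OF e]] by blast
    then have "q $ e i + q $ e CARD('n) = (\<Sum>k\<in>{e i, e CARD('n)}. q $ k)" by simp
    also have "\<dots> \<le> (\<Sum>k\<in>UNIV. q $ k)" using Q(2)[OF q] by (intro sum_mono2) auto
    finally have "q $ e i + q $ e CARD('n) \<le> (\<Sum>k\<in>UNIV. q $ k)" .
    moreover have "q $ e i \<le> q $ e CARD('n)" using i by (intro mono) auto
    ultimately show "1/2 * (\<Sum>k\<in>UNIV. q $ k) \<le> (\<Sum>k\<in>UNIV. q $ k) - q $ e i" by simp
  qed
qed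

end
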